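(* Let $d\ge1$ and let $\mathcal{T}_1,\dots,\mathcal{T}_d$ be weakly mixing flows satisfying the JP property, $\mathcal{T}_i$ acting on $(X_i,\mathcal{B}_i,\mu_i)$. Then every element of the centralizer $C(\mathcal{T}_1\times\dots\times\mathcal{T}_d)$ is, up to a permutation of coordinates between isomorphic factors, a product of elements of the centralizers of the $\mathcal{T}_i$. That is, for every $R\in C(\mathcal{T}_1\times\dots\times\mathcal{T}_d)$ there are a permutation $\sigma$ of $\{1,\dots,d\}$ such that $\mathcal{T}_i$ is isomorphic to $\mathcal{T}_{\sigma(i)}$ for every $i$, and isomorphisms $Q_i\colon X_{\sigma(i)}\to X_i$ between $\mathcal{T}_{\sigma(i)}$ and $\mathcal{T}_i$ (i.e. $T_i^t\circ Q_i=Q_i\circ T_{\sigma(i)}^t$ for all $t$), such that $$R(x_1,\dots,x_d)=(Q_1x_{\sigma(1)},\dots,Q_dx_{\sigma(d)})\quad\text{for a.e. }(x_1,\dots,x_d).$$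
   Context: A flow $\mathcal{T}=(T^t)_{t\in\mathbb{R}}$ is a measure-preserving $\mathbb{R}$-action on a standard Borel probability space $(X,\mathcal{B},\mu)$ such that $t\mapsto\langle f\circ T^t,g\rangle$ is continuous for all $f,g\in L^2(X,\mathcal{B},\mu)$. All flows are assumed nontrivial (the space is not a one-point space up to measure zero). The product flow is $(T_1^t\times\dots\times T_d^t)_{t\in\mathbb{R}}$ on the product probability space. A flow $\mathcal{T}$ is weakly mixing if $\mathcal{T}\times\mathcal{T}$ is ergodic. An isomorphism between flows $\mathcal{S}$ on $Y$ and $\mathcal{T}$ on $X$ is an invertible (mod null sets) measure-preserving map $\Phi\colon Y\to X$ with $T^t\circ\Phi=\Phi\circ S^t$ a.e. for every $t$. The centralizer $C(\mathcal{T})$ is the group of invertible measure-preserving maps of $(X,\mathcal{B},\mu)$ (mod null sets) commuting with all $T^t$. JP property: for flows $\mathcal{T}$ on $(X,\mathcal{B},\mu)$ and $\mathcal{S}$ on $(Y,\mathcal{C},\nu)$, $J(\mathcal{T},\mathcal{S})$ is the set of joinings, i.e. $(T^t\times S^t)_{t\in\mathbb{R}}$-invariant probability measures on $X\times Y$ with marginals $\mu$ and $\nu$; $J^e(\mathcal{T},\mathcal{S})$ is the subset of ergodic ones. An ergodic flow $\mathcal{T}$ on $(X,\mathcal{B},\mu)$ has the joining primeness (JP) property if for any weakly mixing flows $\mathcal{S}_1,\mathcal{S}_2$ on $(Y_1,\mathcal{C}_1,\nu_1)$, $(Y_2,\mathcal{C}_2,\nu_2)$ and every $\lambda\in J^e(\mathcal{T},\mathcal{S}_1\times\mathcal{S}_2)$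 one has $\lambda=\lambda_{X,Y_1}\otimes\nu_2$ or $\lambda=\lambda_{X,Y_2}\otimes\nu_1$, where $\lambda_{X,Y_i}$ is the projection of $\lambda$ onto $X\times Y_i$. *)

theory Defs
  imports "HOL-Probability.Probability" "HOL-Combinatorics.Permutations"
begin

definition standard_borel :: "'a measure \<Rightarrow> bool" where
  "standard_borel M \<longleftrightarrow>
     (\<exists>X. topspace X = space M \<and> completely_metrizable_space X \<and> separable_space X \<and>
          sets M = sigma_sets (space M) {U. openin X U})"

definition L2_fun :: "'a measure \<Rightarrow> ('a \<Rightarrow> complex) set" where
  "L2_fun M = {f \<in> borel_measurable M. integrable M (\<lambda>x. (cmod (f x))\<^sup>2)}"

locale flow = prob_space M for M :: "'a measure" +
  fixes T :: "real \<Rightarrow> 'a \<Rightarrow> 'a"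
  assumes standard: "standard_borel M"
    and nontrivial: "\<not> (\<exists>x\<in>space M. AE y in M. y = x)"
    and measurable_flow: "\<And>t. T t \<in> measurable M M"
    and flow_preserves: "\<And>t. distr M M (T t) = M"
    and flow_zero: "\<And>x. x \<in> space M \<Longrightarrow> T 0 x = x"
    and flow_add: "\<And>s t x. x \<in> space M \<Longrightarrow> T (s + t) x = T s (T t x)"
    and flow_continuous: "\<And>f g. f \<in> L2_fun M \<Longrightarrow> g \<in> L2_fun M \<Longrightarrow>
          continuous_on UNIV (\<lambda>t. LINT x|M. f (T t x) * cnj (g x))"

text \<open>Invariance of a set is understood up to null sets, separately for each time.\<close>

definition ergodic :: "'a measure \<Rightarrow> (real \<Rightarrow> 'a \<Rightarrow> 'a) \<Rightarrow> bool" where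
  "ergodic M T \<longleftrightarrow>
     (\<forall>A\<in>sets M. (\<forall>t. AE x in M. T t x \<in> A \<longleftrightarrow> x \<in> A) \<longrightarrow> measure M A = 0 \<or> measure M A = 1)"

definition pair_flow ::
    "(real \<Rightarrow> 'a \<Rightarrow> 'a) \<Rightarrow> (real \<Rightarrow> 'b \<Rightarrow> 'b) \<Rightarrow> real \<Rightarrow> 'a \<times> 'b \<Rightarrow> 'a \<times> 'b" where
  "pair_flow T S t = map_prod (T t) (S t)"

definition product_flow ::
    "'i set \<Rightarrow> ('i \<Rightarrow> real \<Rightarrow> 'a \<Rightarrow> 'a) \<Rightarrow> real \<Rightarrow> ('i \<Rightarrow> 'a) \<Rightarrow> 'i \<Rightarrow> 'a" where
  "product_flow I T t x = (\<lambda>i\<in>I. T i t (x i))"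

definition weakly_mixing :: "'a measure \<Rightarrow> (real \<Rightarrow> 'a \<Rightarrow> 'a) \<Rightarrow> bool" where
  "weakly_mixing M T \<longleftrightarrow> flow M T \<and> ergodic (M \<Otimes>\<^sub>M M) (pair_flow T T)"

text \<open>A map that is only defined almost everywhere is represented by a total measurable map.\<close>

definition mp_isomorphism :: "'a measure \<Rightarrow> 'b measure \<Rightarrow> ('a \<Rightarrow> 'b) \<Rightarrow> bool" where
  "mp_isomorphism N M \<Phi> \<longleftrightarrow>
     \<Phi> \<in> measurable N M \<and> distr N M \<Phi> = M \<and>
     (\<exists>\<Psi>\<in>measurable M N. (AE y in N. \<Psi> (\<Phi> y) = y) \<and> (AE x in M. \<Phi> (\<Psi> x) = x))"

definition flow_isomorphism ::
    "'a measure \<Rightarrow> (real \<Rightarrow> 'a \<Rightarrow> 'a) \<Rightarrow> 'b measure \<Rightarrow> (real \<Rightarrow> 'b \<Rightarrow> 'b) \<Rightarrow> ('a \<Rightarrow> 'b) \<Rightarrow> bool" where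
  "flow_isomorphism N S M T \<Phi> \<longleftrightarrow>
     mp_isomorphism N M \<Phi> \<and> (\<forall>t. AE y in N. T t (\<Phi> y) = \<Phi> (S t y))"

definition isomorphic_flows ::
    "'a measure \<Rightarrow> (real \<Rightarrow> 'a \<Rightarrow> 'a) \<Rightarrow> 'b measure \<Rightarrow> (real \<Rightarrow> 'b \<Rightarrow> 'b) \<Rightarrow> bool" where
  "isomorphic_flows N S M T \<longleftrightarrow> (\<exists>\<Phi>. flow_isomorphism N S M T \<Phi>)"

definition centralizer :: "'a measure \<Rightarrow> (real \<Rightarrow> 'a \<Rightarrow> 'a) \<Rightarrow> ('a \<Rightarrow> 'a) set" where
  "centralizer M T =
     {R. mp_isomorphism M M R \<and> (\<forall>t. AE x in M. R (T t x) = T t (R x))}"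

definition joinings ::
    "'a measure \<Rightarrow> (real \<Rightarrow> 'a \<Rightarrow> 'a) \<Rightarrow> 'b measure \<Rightarrow> (real \<Rightarrow> 'b \<Rightarrow> 'b) \<Rightarrow> ('a \<times> 'b) measure set" where
  "joinings M T N S =
     {\<rho>. prob_space \<rho> \<and> sets \<rho> = sets (M \<Otimes>\<^sub>M N) \<and>
         distr \<rho> M fst = M \<and> distr \<rho> N snd = N \<and>
         (\<forall>t. distr \<rho> (M \<Otimes>\<^sub>M N) (pair_flow T S t) = \<rho>)}"

definition ergodic_joinings ::
    "'a measure \<Rightarrow> (real \<Rightarrow> 'a \<Rightarrow> 'a) \<Rightarrow> 'b measure \<Rightarrow> (real \<Rightarrow> 'b \<Rightarrow> 'b) \<Rightarrow> ('a \<times> 'b) measure set" where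
  "ergodic_joinings M T N S = {\<rho> \<in> joinings M T N S. ergodic \<rho> (pair_flow T S)}"

text \<open>
  A definition cannot quantify over types, so the flows \<open>S1\<close>, \<open>S2\<close> live on arbitrary subsets of
  the reals. Up to isomorphism these are all flows: a standard Borel space has at most continuum
  many points, hence injects into the reals, and its Polish topology, its sigma-algebra, the
  measure and the flow can be carried over to the image. The sigma-algebra of \<open>N1\<close>, \<open>N2\<close> need
  not be related to the usual Borel sets of the reals.

  The two alternatives are equalities of measures on \<open>X \<times> (Y1 \<times> Y2)\<close> after rearranging the
  coordinates of \<open>(X \<times> Y1) \<times> Y2\<close> and \<open>(X \<times> Y2) \<times> Y1\<close>.
\<close>

definition joining_prime :: "'a measure \<Rightarrow> (real \<Rightarrow> 'a \<Rightarrow> 'a) \<Rightarrow> bool" where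
  "joining_prime M T \<longleftrightarrow>
     flow M T \<and> ergodic M T \<and>
     (\<forall>(N1 :: real measure) S1 (N2 :: real measure) S2.
        weakly_mixing N1 S1 \<longrightarrow> weakly_mixing N2 S2 \<longrightarrow>
        (\<forall>\<rho> \<in> ergodic_joinings M T (N1 \<Otimes>\<^sub>M N2) (pair_flow S1 S2).
           \<rho> = distr (distr \<rho> (M \<Otimes>\<^sub>M N1) (\<lambda>(x, y1, y2). (x, y1)) \<Otimes>\<^sub>M N2)
                 (M \<Otimes>\<^sub>M (N1 \<Otimes>\<^sub>M N2)) (\<lambda>((x, y1), y2). (x, y1, y2)) \<or>
           \<rho> = distr (distr \<rho> (M \<Otimes>\<^sub>M N2) (\<lambda>(x, y1, y2). (x, y2)) \<Otimes>\<^sub>M N1)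
                 (M \<Otimes>\<^sub>M (N1 \<Otimes>\<^sub>M N2)) (\<lambda>((x, y2), y1). (x, y1, y2))))"

end

theory Submission
  imports Defs
begin

text \<open>
  Let \<open>R\<close> commute with the product flow. Each coordinate \<open>R\<^sub>i\<close> of \<open>R\<close> is a factor map from
  the product flow onto \<open>T\<^sub>i\<close>. Suppose that a factor map \<open>g\<close> onto a flow with the joining
  primeness (JP) property starts from a product \<open>S\<^sub>1 \<times> S\<^sub>2\<close> of weakly mixing flows. The law of
  \<open>(g y, y)\<close> is an ergodic joining, so JP makes one coordinate, say \<open>y\<^sub>2\<close>, independent of
  \<open>(g y, y\<^sub>1)\<close>. The identity \<open>x = g (y\<^sub>1, y\<^sub>2)\<close> that holds almost surely under this law therefore
  survives when \<open>y\<^sub>2\<close> is replaced by an independent copy. By Fubini, \<open>y\<^sub>2\<close> can be frozen at a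
  generic value, and \<open>g\<close> depends on \<open>y\<^sub>1\<close> alone (\<open>joining_prime_factor\<close>). Splitting off one
  coordinate at a time gives \<open>R\<^sub>i x = Q\<^sub>i (x (s i))\<close> for some index \<open>s i\<close>
  (\<open>joining_prime_factor_PiM\<close>).

  Since \<open>R\<close> has an inverse \<open>\<Psi>\<close>, the coordinate \<open>x j\<close> is a function of the points \<open>Q\<^sub>i (x (s i))\<close>.
  Freezing all coordinates except the \<open>j\<close>-th at generic values, \<open>x j\<close> is recovered from those
  \<open>Q\<^sub>i (x (s i))\<close> with \<open>s i = j\<close>. If there were no such \<open>i\<close>, then \<open>x j\<close> would be almost surely
  constant, contradicting nontriviality. So \<open>s\<close> is surjective, hence a permutation,
  and the same formula then provides the inverse of \<open>Q\<^sub>i\<close>.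

  Two supporting facts take most of the work. Applying JP to more than two factors needs that
  products of weakly mixing flows are weakly mixing flows: ergodicity is \<open>ergodic_pair\<close>, and
  continuity is obtained from continuity in mean of indicator functions. Moreover JP is
  stated for flows on subsets of the reals, so flows are transported along Borel isomorphisms,
  using that a standard Borel space injects into the reals.
\<close>

section \<open>Standard Borel spaces\<close>

lemma second_countable_if_separable_metrizable:
  assumes "metrizable_space X" "separable_space X"
  shows "second_countable X"
proof -
  obtain M d where "Metric_space M d" and X: "X = Metric_space.mtopology M d"
    using assms(1) by (auto simp: metrizable_space_def)
  interpret Metric_space M d by fact
  obtain C where C: "countable C" "C \<subseteq> M" "mtopology closure_of C = M"
    using assms(2) by (auto simp: separable_space_def X)
  define \<B> where "\<B> = (\<lambda>(c, n). mball c (inverse (Suc n))) ` (C \<times> (UNIV :: nat set))"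
  have "\<exists>V\<in>\<B>. x \<in> V \<and> V \<subseteq> U" if U: "openin mtopology U" "x \<in> U" for U x
  proof -
    obtain r where r: "r > 0" "mball x r \<subseteq> U"
      using U openin_mtopology by auto
    have xM: "x \<in> M" using U openin_mtopology by blast
    obtain n where n: "inverse (Suc n) < r / 2"
      using reals_Archimedean[of "r / 2"] r by auto
    have "x \<in> mtopology closure_of C" using C xM by simp
    then obtain c where c: "c \<in> C" "c \<in> mball x (inverse (Suc n))"
      unfolding in_closure_of
      by (metis centre_in_mball_iff of_nat_0_less_iff openin_mball positive_imp_inverse_positive
          xM zero_less_Suc)
    have "mball c (inverse (Suc n)) \<subseteq> mball x r"
    proof
      fix z assume z: "z \<in> mball c (inverse (Suc n))"
      then have "d x z \<le> d x c + d c z" using c xM by (intro triangle) auto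
      with z c n show "z \<in> mball x r" using xM by auto
    qed
    moreover have "x \<in> mball c (inverse (Suc n))" using c xM by (auto simp: commute)
    ultimately show ?thesis using c r unfolding \<B>_def by (intro bexI[of _ "mball c (inverse (Suc n))"]) auto
  qed
  moreover have "countable \<B>" using C by (simp add: \<B>_def)
  moreover have "\<forall>V\<in>\<B>. openin mtopology V" by (auto simp: \<B>_def)
  ultimately show ?thesis unfolding second_countable_def X by metis
qed

lemma standard_borel_second_countable:
  assumes "standard_borel M"
  obtains X where "topspace X = space M" "completely_metrizable_space X" "separable_space X"
    "second_countable X" "sets M = sigma_sets (space M) {U. openin X U}"
  using assms unfolding standard_borel_def
  by (metis completely_metrizable_imp_metrizable_space second_countable_if_separable_metrizable)

text \<open>A countable base of the topology separates points.\<close>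

lemma standard_borel_separating:
  assumes "standard_borel M"
  obtains B :: "nat \<Rightarrow> 'a set" where "\<And>n. B n \<in> sets M"
    "\<And>x y. x \<in> space M \<Longrightarrow> y \<in> space M \<Longrightarrow> (\<And>n. x \<in> B n \<longleftrightarrow> y \<in> B n) \<Longrightarrow> x = y"
proof -
  obtain X where X: "topspace X = space M" "completely_metrizable_space X" "second_countable X"
      "sets M = sigma_sets (space M) {U. openin X U}"
    using standard_borel_second_countable[OF assms] by metis
  obtain \<B> where \<B>: "countable \<B>" "\<And>V. V \<in> \<B> \<Longrightarrow> openin X V"
      "\<And>U x. openin X U \<Longrightarrow> x \<in> U \<Longrightarrow> \<exists>V \<in> \<B>. x \<in> V \<and> V \<subseteq> U"
    using X(3) unfolding second_countable_def by meson
  have haus: "Hausdorff_space X"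
    by (intro metrizable_imp_Hausdorff_space completely_metrizable_imp_metrizable_space X)
  define B where "B = from_nat_into (insert {} \<B>)"
  have rB: "range B = insert {} \<B>"
    unfolding B_def using \<B>(1) by (intro range_from_nat_into) auto
  show thesis
  proof
    fix n
    have "B n \<in> insert {} \<B>" using rB by blast
    then have "openin X (B n)" using \<B>(2) by auto
    then show "B n \<in> sets M" unfolding X(4) by (auto intro: sigma_sets.Basic)
  next
    fix x y assume xy: "x \<in> space M" "y \<in> space M" and *: "\<And>n. x \<in> B n \<longleftrightarrow> y \<in> B n"
    show "x = y"
    proof (rule ccontr)
      assume "x \<noteq> y"
      then obtain U V where "openin X U" "openin X V" "x \<in> U" "y \<in> V" "disjnt U V"
        using haus xy X(1) unfolding Hausdorff_space_def by metis
      moreover obtain W where "W \<in> \<B>" "x \<in> W" "W \<subseteq> U"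
        using \<B>(3) \<open>openin X U\<close> \<open>x \<in> U\<close> by blast
      moreover from this obtain n where "W = B n" using rB by (metis insertCI rangeE)
      ultimately show False using * unfolding disjnt_def by blast
    qed
  qed
qed

lemma standard_borel_inj_real:
  assumes "standard_borel (M :: 'a measure)"
  obtains f :: "'a \<Rightarrow> real" where "inj_on f (space M)"
proof -
  obtain B :: "nat \<Rightarrow> 'a set" where B: "\<And>n. B n \<in> sets M"
    "\<And>x y. x \<in> space M \<Longrightarrow> y \<in> space M \<Longrightarrow> (\<And>n. x \<in> B n \<longleftrightarrow> y \<in> B n) \<Longrightarrow> x = y"
    using standard_borel_separating[OF assms] by metis
  obtain h :: "nat set \<Rightarrow> real" where h: "bij h"
    using nat_sets_eqpoll_reals by (auto simp: eqpoll_def)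
  have "inj_on (\<lambda>x. h {n. x \<in> B n}) (space M)"
    by (rule inj_onI, rule B(2)) (auto dest!: injD[OF bij_is_inj[OF h]])
  then show thesis by (rule that)
qed

text \<open>
  Used to pass almost-everywhere identities to image measures and through Fubini, where
  measurability of the exceptional set is required.
\<close>

lemma sets_equalizer:
  assumes "standard_borel N" "f \<in> measurable M N" "g \<in> measurable M N"
  shows "{x\<in>space M. f x = g x} \<in> sets M"
proof -
  obtain B where B: "\<And>n::nat. B n \<in> sets N"
    "\<And>x y. x \<in> space N \<Longrightarrow> y \<in> space N \<Longrightarrow> (\<And>n. x \<in> B n \<longleftrightarrow> y \<in> B n) \<Longrightarrow> x = y"
    using standard_borel_separating[OF assms(1)] by metis
  note [measurable] = assms(2,3) B(1)
  have "{x\<in>space M. f x = g x} = {x\<in>space M. \<forall>n. f x \<in> B n \<longleftrightarrow> g x \<in> B n}"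
    using B(2) measurable_space[OF assms(2)] measurable_space[OF assms(3)] by auto
  also have "\<dots> \<in> sets M" by measurable
  finally show ?thesis .
qed

lemma standard_borel_pair:
  assumes "standard_borel M" "standard_borel N"
  shows "standard_borel (M \<Otimes>\<^sub>M N)"
proof -
  obtain X where X: "topspace X = space M" "completely_metrizable_space X" "separable_space X"
      "second_countable X" "sets M = sigma_sets (space M) {U. openin X U}"
    using standard_borel_second_countable[OF assms(1)] by metis
  obtain Y where Y: "topspace Y = space N" "completely_metrizable_space Y" "separable_space Y"
      "second_countable Y" "sets N = sigma_sets (space N) {U. openin Y U}"
    using standard_borel_second_countable[OF assms(2)] by metis
  let ?Z = "prod_topology X Y"
  obtain \<A> where \<A>: "countable \<A>" "\<And>V. V \<in> \<A> \<Longrightarrow> openin X V"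
      "\<And>U x. openin X U \<Longrightarrow> x \<in> U \<Longrightarrow> \<exists>V \<in> \<A>. x \<in> V \<and> V \<subseteq> U"
    using X(4) unfolding second_countable_def by meson
  obtain \<B> where \<B>: "countable \<B>" "\<And>V. V \<in> \<B> \<Longrightarrow> openin Y V"
      "\<And>U x. openin Y U \<Longrightarrow> x \<in> U \<Longrightarrow> \<exists>V \<in> \<B>. x \<in> V \<and> V \<subseteq> U"
    using Y(4) unfolding second_countable_def by meson
  have base: "\<exists>V\<in>\<A>. \<exists>W\<in>\<B>. x \<in> V \<times> W \<and> V \<times> W \<subseteq> U" if U: "openin ?Z U" "x \<in> U" for U x
  proof -
    obtain S T where ST: "openin X S" "openin Y T" "fst x \<in> S" "snd x \<in> T" "S \<times> T \<subseteq> U"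
      using U(1)[unfolded openin_prod_topology_alt, rule_format, of "fst x" "snd x"] U(2) by auto
    obtain V W where "V \<in> \<A>" "fst x \<in> V" "V \<subseteq> S" "W \<in> \<B>" "snd x \<in> W" "W \<subseteq> T"
      using \<A>(3)[OF ST(1,3)] \<B>(3)[OF ST(2,4)] by blast
    moreover from this ST(5) have "x \<in> V \<times> W" "V \<times> W \<subseteq> U"
      by (auto simp: mem_Times_iff)
    ultimately show ?thesis by (intro bexI[of _ V] bexI[of _ W] conjI)
  qed
  have Z: "second_countable ?Z"
    unfolding second_countable_def
  proof (intro exI conjI)
    show "countable ((\<lambda>(V, W). V \<times> W) ` (\<A> \<times> \<B>))" using \<A>(1) \<B>(1) by auto
    show "\<forall>V\<in>(\<lambda>(V, W). V \<times> W) ` (\<A> \<times> \<B>). openin ?Z V"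
      using \<A>(2) \<B>(2) by (auto simp: openin_prod_Times_iff)
    show "\<forall>U x. openin ?Z U \<and> x \<in> U \<longrightarrow> (\<exists>V\<in>(\<lambda>(V, W). V \<times> W) ` (\<A> \<times> \<B>). x \<in> V \<and> V \<subseteq> U)"
    proof (intro allI impI, elim conjE)
      fix U x assume "openin ?Z U" "x \<in> U"
      then obtain V W where "V \<in> \<A>" "W \<in> \<B>" "x \<in> V \<times> W" "V \<times> W \<subseteq> U"
        using base[of U x] by blast
      then show "\<exists>V\<in>(\<lambda>(V, W). V \<times> W) ` (\<A> \<times> \<B>). x \<in> V \<and> V \<subseteq> U"
        by (intro bexI[of _ "V \<times> W"]) auto
    qed
  qed
  \<comment> \<open>Every open set of the product is a countable union of open boxes, so the Borel
    \<open>\<sigma>\<close>-algebra \<open>?S\<close> of the product topology is no larger than the product \<open>\<sigma>\<close>-algebra.\<close>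
  let ?S = "sigma (space M \<times> space N) {U. openin ?Z U}"
  have topZ: "topspace ?Z = space M \<times> space N" by (simp add: X(1) Y(1))
  have sub: "{U. openin ?Z U} \<subseteq> Pow (space M \<times> space N)"
    using openin_subset[of ?Z, unfolded topZ] by auto
  have sp: "space ?S = space M \<times> space N" using sub by (simp add: space_measure_of)
  have "U \<in> sets (M \<Otimes>\<^sub>M N)" if U: "openin ?Z U" for U
  proof -
    let ?I = "{(V, W). V \<in> \<A> \<and> W \<in> \<B> \<and> V \<times> W \<subseteq> U}"
    have "countable ?I"
      by (rule countable_subset[of _ "\<A> \<times> \<B>"]) (use \<A>(1) \<B>(1) in auto)
    moreover have "U = (\<Union>(V, W)\<in>?I. V \<times> W)"
    proof (intro equalityI subsetI)
      fix x assume "x \<in> U"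
      then obtain V W where "V \<in> \<A>" "W \<in> \<B>" "x \<in> V \<times> W" "V \<times> W \<subseteq> U"
        using base[OF U, of x] by blast
      then show "x \<in> (\<Union>(V, W)\<in>?I. V \<times> W)" by (intro UN_I[of "(V, W)"]) auto
    qed auto
    moreover have "V \<times> W \<in> sets (M \<Otimes>\<^sub>M N)" if "V \<in> \<A>" "W \<in> \<B>" for V W
      using \<A>(2)[OF that(1)] \<B>(2)[OF that(2)] X(5) Y(5)
      by (intro pair_measureI) (auto intro: sigma_sets.Basic)
    moreover have "(\<Union>(V, W)\<in>?I. V \<times> W) \<in> sets (M \<Otimes>\<^sub>M N)"
      using \<open>countable ?I\<close> calculation(3) by (intro sets.countable_UN') auto
    ultimately show ?thesis by simp
  qed
  moreover have "sets (M \<Otimes>\<^sub>M N) \<subseteq> sets ?S"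
  proof
    fix A assume A: "A \<in> sets (M \<Otimes>\<^sub>M N)"
    have "fst \<in> measurable ?S M"
    proof (rule measurable_sigma_sets[OF X(5)])
      show "{U. openin X U} \<subseteq> Pow (space M)" using X(1) by (auto dest: openin_subset)
      show "fst \<in> space ?S \<rightarrow> space M" by (auto simp: sp)
      fix U assume "U \<in> {U. openin X U}"
      then have "openin ?Z (U \<times> topspace Y)" by (simp add: openin_prod_Times_iff)
      moreover have "fst -` U \<inter> space ?S = U \<times> topspace Y"
        using \<open>U \<in> _\<close> X(1) Y(1) by (auto simp: sp dest: openin_subset)
      ultimately show "fst -` U \<inter> space ?S \<in> sets ?S"
        using sub by (simp add: sigma_sets.Basic)
    qed
    moreover have "snd \<in> measurable ?S N"
    proof (rule measurable_sigma_sets[OF Y(5)])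
      show "{U. openin Y U} \<subseteq> Pow (space N)" using Y(1) by (auto dest: openin_subset)
      show "snd \<in> space ?S \<rightarrow> space N" by (auto simp: sp)
      fix U assume "U \<in> {U. openin Y U}"
      then have "openin ?Z (topspace X \<times> U)" by (simp add: openin_prod_Times_iff)
      moreover have "snd -` U \<inter> space ?S = topspace X \<times> U"
        using \<open>U \<in> _\<close> X(1) Y(1) by (auto simp: sp dest: openin_subset)
      ultimately show "snd -` U \<inter> space ?S \<in> sets ?S"
        using sub by (simp add: sigma_sets.Basic)
    qed
    ultimately have "(\<lambda>x. (fst x, snd x)) \<in> measurable ?S (M \<Otimes>\<^sub>M N)" by measurable
    from measurable_sets[OF this A] show "A \<in> sets ?S"
      using sets.sets_into_space[OF A] by (simp add: sp space_pair_measure Int_absorb2)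
  qed
  ultimately have "sets (M \<Otimes>\<^sub>M N) = sigma_sets (space (M \<Otimes>\<^sub>M N)) {U. openin ?Z U}"
    using sub sets.sigma_sets_subset[of "{U. openin ?Z U}" "M \<Otimes>\<^sub>M N"]
    by (auto simp: space_pair_measure)
  moreover have "topspace ?Z = space (M \<Otimes>\<^sub>M N)"
    by (simp add: X(1) Y(1) space_pair_measure)
  moreover have "completely_metrizable_space ?Z"
    by (simp add: completely_metrizable_space_prod_topology X(2) Y(2))
  ultimately show ?thesis
    unfolding standard_borel_def using second_countable_imp_separable_space[OF Z] by blast
qed

text \<open>The Polish topology is carried along a bimeasurable bijection by pulling it back.\<close>

lemma standard_borel_transfer:
  assumes M: "standard_borel M" and \<phi>: "\<phi> \<in> measurable M N" and \<psi>: "\<psi> \<in> measurable N M"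
    and \<psi>\<phi>: "\<And>x. x \<in> space M \<Longrightarrow> \<psi> (\<phi> x) = x" and \<phi>\<psi>: "\<And>y. y \<in> space N \<Longrightarrow> \<phi> (\<psi> y) = y"
  shows "standard_borel N"
proof -
  obtain X where X: "topspace X = space M" "completely_metrizable_space X" "separable_space X"
      "sets M = sigma_sets (space M) {U. openin X U}"
    using M by (auto simp: standard_borel_def)
  define Y where "Y = pullback_topology (space N) \<psi> X"
  have topY: "topspace Y = space N"
    using measurable_space[OF \<psi>] by (auto simp: Y_def topspace_pullback_topology X(1))
  have "homeomorphic_maps X Y \<phi> \<psi>"
    unfolding homeomorphic_maps_def
  proof (intro conjI)
    show "continuous_map X Y \<phi>"
      unfolding continuous_map_def
    proof (intro conjI allI impI)
      show "\<phi> \<in> topspace X \<rightarrow> topspace Y" using measurable_space[OF \<phi>] by (auto simp: X topY)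
      fix U assume "openin Y U"
      then obtain V where V: "openin X V" "U = \<psi> -` V \<inter> space N"
        by (auto simp: Y_def openin_pullback_topology)
      have "{x \<in> topspace X. \<phi> x \<in> U} = V"
        using V(2) \<psi>\<phi> measurable_space[OF \<phi>] openin_subset[OF V(1)] by (auto simp: X)
      then show "openin X {x \<in> topspace X. \<phi> x \<in> U}" using V by simp
    qed
    show "continuous_map Y X \<psi>"
      unfolding continuous_map_def
    proof (intro conjI allI impI)
      show "\<psi> \<in> topspace Y \<rightarrow> topspace X" using measurable_space[OF \<psi>] by (auto simp: X topY)
      fix U assume "openin X U"
      then show "openin Y {y \<in> topspace Y. \<psi> y \<in> U}"
        unfolding topY by (auto simp: Y_def openin_pullback_topology intro!: exI[of _ U])
    qed
  qed (auto simp: \<psi>\<phi> \<phi>\<psi> X topY)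
  then have homeo: "X homeomorphic_space Y" by (auto simp: homeomorphic_space_def)
  have "sets N = {\<psi> -` A \<inter> space N |A. A \<in> sets M}"
  proof safe
    fix B assume B: "B \<in> sets N"
    have "B = \<psi> -` (\<phi> -` B \<inter> space M) \<inter> space N"
      using sets.sets_into_space[OF B] \<phi>\<psi> measurable_space[OF \<psi>] by auto
    then show "\<exists>A. B = \<psi> -` A \<inter> space N \<and> A \<in> sets M"
      using measurable_sets[OF \<phi> B] by blast
  qed (rule measurable_sets[OF \<psi>])
  also have "\<dots> = sigma_sets (space N) {\<psi> -` A \<inter> space N |A. A \<in> {U. openin X U}}"
    unfolding X(4) using measurable_space[OF \<psi>] by (intro sigma_sets_vimage_commute) auto
  also have "{\<psi> -` A \<inter> space N |A. A \<in> {U. openin X U}} = {U. openin Y U}"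
    by (auto simp: Y_def openin_pullback_topology)
  finally show ?thesis
    unfolding standard_borel_def using X(2,3) homeo topY
      homeomorphic_completely_metrizable_space homeomorphic_separable_space by blast
qed

section \<open>Ergodicity of products with a weakly mixing factor\<close>

text \<open>
  A family of measure preserving maps of a probability space, indexed by the reals. No group
  law and no continuity is demanded: the ergodicity arguments use neither.
\<close>

definition preserving :: "'a measure \<Rightarrow> (real \<Rightarrow> 'a \<Rightarrow> 'a) \<Rightarrow> bool" where
  "preserving M T \<longleftrightarrow> prob_space M \<and> (\<forall>t. T t \<in> measurable M M \<and> distr M M (T t) = M)"

lemma flow_preserving: "flow M T \<Longrightarrow> preserving M T"
  unfolding preserving_def by (metis flow.axioms(1) flow.measurable_flow flow.flow_preserves)

lemma AE_measure_preserving: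
  assumes "f \<in> measurable M N" "distr M N f = N" "AE y in N. P y"
  shows "AE x in M. P (f x)"
  by (rule AE_distrD[OF assms(1)]) (subst assms(2), rule assms(3))

lemma distr_pair_fst:
  assumes "sigma_finite_measure M" "prob_space N"
  shows "distr (M \<Otimes>\<^sub>M N) M fst = M"
proof (rule measure_eqI)
  interpret N: prob_space N by fact
  fix A assume "A \<in> sets (distr (M \<Otimes>\<^sub>M N) M fst)"
  then have A: "A \<in> sets M" by simp
  then have "fst -` A \<inter> space (M \<Otimes>\<^sub>M N) = A \<times> space N"
    by (auto simp: space_pair_measure dest: sets.sets_into_space)
  then show "emeasure (distr (M \<Otimes>\<^sub>M N) M fst) A = emeasure M A"
    using A by (simp add: emeasure_distr N.emeasure_pair_measure_Times N.emeasure_space_1)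
qed simp

lemma distr_pair_snd:
  assumes "prob_space M" "sigma_finite_measure N"
  shows "distr (M \<Otimes>\<^sub>M N) N snd = N"
proof (rule measure_eqI)
  interpret M: prob_space M by fact
  interpret N: sigma_finite_measure N by fact
  fix A assume "A \<in> sets (distr (M \<Otimes>\<^sub>M N) N snd)"
  then have A: "A \<in> sets N" by simp
  then have "snd -` A \<inter> space (M \<Otimes>\<^sub>M N) = space M \<times> A"
    by (auto simp: space_pair_measure dest: sets.sets_into_space)
  then show "emeasure (distr (M \<Otimes>\<^sub>M N) N snd) A = emeasure N A"
    using A by (simp add: emeasure_distr N.emeasure_pair_measure_Times M.emeasure_space_1)
qed simp

lemma measure_pair_Times:
  assumes "sigma_finite_measure N" "A \<in> sets M" "B \<in> sets N"
  shows "measure (M \<Otimes>\<^sub>M N) (A \<times> B) = measure M A * measure N B"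
  using assms by (simp add: measure_def sigma_finite_measure.emeasure_pair_measure_Times enn2real_mult)

lemma AE_pair_fstI:
  assumes "sigma_finite_measure M" "prob_space N" "AE x in M. P x"
  shows "AE z in M \<Otimes>\<^sub>M N. P (fst z)"
  using assms by (intro AE_measure_preserving[of fst _ M] distr_pair_fst) auto

lemma AE_pair_sndI:
  assumes "prob_space M" "sigma_finite_measure N" "AE x in N. P x"
  shows "AE z in M \<Otimes>\<^sub>M N. P (snd z)"
  using assms by (intro AE_measure_preserving[of snd _ N] distr_pair_snd) auto

lemma preserving_pair:
  assumes "preserving M T" "preserving N S"
  shows "preserving (M \<Otimes>\<^sub>M N) (pair_flow T S)"
proof -
  interpret M: prob_space M using assms by (simp add: preserving_def)
  interpret N: prob_space N using assms by (simp add: preserving_def)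
  interpret MN: pair_prob_space M N ..
  have *: "pair_flow T S t = (\<lambda>(x, y). (T t x, S t y))" for t
    by (auto simp: pair_flow_def)
  have [measurable]: "T t \<in> measurable M M" "S t \<in> measurable N N" for t
    using assms by (auto simp: preserving_def)
  have "distr (M \<Otimes>\<^sub>M N) (M \<Otimes>\<^sub>M N) (pair_flow T S t) = M \<Otimes>\<^sub>M N" for t
    using pair_measure_distr[of "T t" M M "S t" N N] assms N.sigma_finite_measure_axioms
    by (simp add: * preserving_def)
  then show ?thesis
    unfolding preserving_def using MN.P.prob_space_axioms by (auto simp: *)
qed

lemma preserving_AE:
  assumes "preserving M T" "AE x in M. P x"
  shows "AE x in M. P (T t x)"
  using assms by (intro AE_measure_preserving[of "T t" M M]) (auto simp: preserving_def)

lemma ergodic_invariant_const: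
  fixes f :: "'a \<Rightarrow> real"
  assumes "preserving M T" "ergodic M T" and f: "integrable M f"
    and inv: "\<And>t. AE x in M. f (T t x) = f x"
  shows "AE x in M. f x = integral\<^sup>L M f"
proof -
  interpret prob_space M using assms by (simp add: preserving_def)
  have T: "T t \<in> measurable M M" for t using assms by (simp add: preserving_def)
  note [measurable] = borel_measurable_integrable[OF f]
  let ?c = "integral\<^sup>L M f"
  \<comment> \<open>The sets \<open>{f < c}\<close> and \<open>{f > c}\<close>, with \<open>c\<close> the mean, are invariant; neither can have
    full measure, as that would move the mean.\<close>
  have zero_one: "prob {x\<in>space M. Q (f x)} = 0 \<or> prob {x\<in>space M. Q (f x)} = 1"
    if [measurable]: "Measurable.pred borel Q" for Q
  proof (rule assms(2)[unfolded ergodic_def, rule_format])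
    fix t
    show "AE x in M. T t x \<in> {x\<in>space M. Q (f x)} \<longleftrightarrow> x \<in> {x\<in>space M. Q (f x)}"
      using inv[of t] AE_space by eventually_elim (use measurable_space[OF T] in auto)
  qed measurable
  have "prob {x\<in>space M. f x < ?c} = 0 \<or> prob {x\<in>space M. f x < ?c} = 1"
    by (rule zero_one) measurable
  moreover have "prob {x\<in>space M. f x < ?c} \<noteq> 1"
    using expectation_less[OF f, of ?c] by (auto simp: prob_Collect_eq_1)
  ultimately have 1: "AE x in M. \<not> f x < ?c" by (simp add: prob_Collect_eq_0)
  have "prob {x\<in>space M. f x > ?c} = 0 \<or> prob {x\<in>space M. f x > ?c} = 1"
    by (rule zero_one) measurable
  moreover have "prob {x\<in>space M. f x > ?c} \<noteq> 1"
    using expectation_greater[OF f, of ?c] by (auto simp: prob_Collect_eq_1)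
  ultimately have 2: "AE x in M. \<not> f x > ?c" by (simp add: prob_Collect_eq_0)
  from 1 2 show ?thesis by eventually_elim auto
qed

lemma ergodic_factor:
  assumes "prob_space M" "\<phi> \<in> measurable M N" "distr M N \<phi> = N" "ergodic M T"
    and eq: "\<And>t. AE x in M. \<phi> (T t x) = S t (\<phi> x)" and T: "\<And>t. T t \<in> measurable M M"
  shows "ergodic N S"
  unfolding ergodic_def
proof (intro ballI impI)
  fix A assume A: "A \<in> sets N" and inv: "\<forall>t. AE x in N. S t x \<in> A \<longleftrightarrow> x \<in> A"
  let ?B = "\<phi> -` A \<inter> space M"
  have B: "?B \<in> sets M" using A assms(2) by measurable
  have "AE x in M. T t x \<in> ?B \<longleftrightarrow> x \<in> ?B" for t
  proof -
    have "AE x in M. S t (\<phi> x) \<in> A \<longleftrightarrow> \<phi> x \<in> A"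
      using inv by (intro AE_measure_preserving[OF assms(2,3)]) auto
    with eq[of t] show ?thesis
      using AE_space by eventually_elim (use measurable_space[OF T[of t]] in auto)
  qed
  then have "measure M ?B = 0 \<or> measure M ?B = 1"
    using assms(4) B unfolding ergodic_def by blast
  moreover have "measure N A = measure M ?B"
    using measure_distr[OF assms(2) A] assms(3) by simp
  ultimately show "measure N A = 0 \<or> measure N A = 1" by simp
qed

text \<open>
  If \<open>T \<times> T\<close> and \<open>S\<close> are ergodic, then so is \<open>T \<times> S\<close>. Let \<open>A\<close> be invariant of measure \<open>m\<close> and
  write \<open>A\<^sub>x\<close>, \<open>A\<^sup>y\<close> for its sections. The kernel \<open>K (x, x') = \<nu> (A\<^sub>x \<inter> A\<^sub>x')\<close> is invariant under
  \<open>T \<times> T\<close>, hence almost everywhere equal to a constant \<open>c\<close>. For measurable \<open>B\<close>, the function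
  \<open>v B y = \<mu> (A\<^sup>y \<inter> B)\<close> has mean \<open>m * \<mu> B\<close> by ergodicity of \<open>T\<close>, and second moment \<open>c * (\<mu> B)\<^sup>2\<close>;
  taking for \<open>B\<close> the whole space and using ergodicity of \<open>S\<close> gives \<open>c = m\<^sup>2\<close>. So \<open>v B\<close> has
  variance zero, which says that \<open>A\<close> is independent of every rectangle, thus of every set,
  in particular of itself: \<open>m = m * m\<close>.
\<close>

theorem ergodic_pair:
  assumes pM: "preserving M T" and pN: "preserving N S"
    and eM: "ergodic (M \<Otimes>\<^sub>M M) (pair_flow T T)" and eN: "ergodic N S"
  shows "ergodic (M \<Otimes>\<^sub>M N) (pair_flow T S)"
  unfolding ergodic_def
proof (intro ballI impI)
  fix A assume A[measurable]: "A \<in> sets (M \<Otimes>\<^sub>M N)"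
    and inv: "\<forall>t. AE z in M \<Otimes>\<^sub>M N. pair_flow T S t z \<in> A \<longleftrightarrow> z \<in> A"
  interpret M: prob_space M using pM by (simp add: preserving_def)
  interpret N: prob_space N using pN by (simp add: preserving_def)
  interpret MN: pair_prob_space M N ..
  interpret MM: pair_prob_space M M ..
  interpret MMN: pair_prob_space "M \<Otimes>\<^sub>M M" N ..
  have T[measurable]: "T t \<in> measurable M M" and S[measurable]: "S t \<in> measurable N N" for t
    using pM pN by (auto simp: preserving_def)
  have dT: "distr M M (T t) = M" and dS: "distr N N (S t) = N" for t
    using pM pN by (auto simp: preserving_def)
  have eT: "ergodic M T"
    by (rule ergodic_factor[OF MM.P.prob_space_axioms _ _ eM, of fst])
       (use preserving_pair[OF pM pM] in \<open>auto simp: distr_pair_fst M.prob_space_axioms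
          M.sigma_finite_measure_axioms pair_flow_def preserving_def\<close>)
  define a :: "'a \<Rightarrow> 'b \<Rightarrow> real" where "a x y = indicator A (x, y)" for x y
  have a_meas[measurable]: "(\<lambda>w. a (f w) (g w)) \<in> borel_measurable W"
    if "f \<in> measurable W M" "g \<in> measurable W N" for f g and W :: "'w measure"
    unfolding a_def using that by measurable
  have a01: "0 \<le> a x y" "a x y \<le> 1" for x y by (auto simp: a_def indicator_def)
  have ainv: "AE x in M. AE y in N. a (T t x) (S t y) = a x y" for t
  proof -
    have "AE z in M \<Otimes>\<^sub>M N. a (T t (fst z)) (S t (snd z)) = a (fst z) (snd z)"
      using inv[rule_format, of t] by eventually_elim (auto simp: a_def pair_flow_def indicator_def)
    from MN.AE_pair[OF this] show ?thesis by simp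
  qed

  define K where "K z = (\<integral>y. a (fst z) y * a (snd z) y \<partial>N)" for z
  have K_meas[measurable]: "K \<in> borel_measurable (M \<Otimes>\<^sub>M M)"
    unfolding K_def by measurable
  have K_int: "integrable (M \<Otimes>\<^sub>M M) K"
  proof (rule MM.P.integrable_const_bound[of _ 1])
    show "AE z in M \<Otimes>\<^sub>M M. norm (K z) \<le> 1"
    proof (rule AE_I2)
      fix z assume "z \<in> space (M \<Otimes>\<^sub>M M)"
      then have [measurable]: "fst z \<in> space M" "snd z \<in> space M" by (auto simp: space_pair_measure)
      have "0 \<le> K z" unfolding K_def using a01 by (intro integral_nonneg_AE) auto
      moreover have "K z \<le> 1" unfolding K_def
        by (intro N.integral_le_const N.integrable_const_bound[of _ 1])
           (use a01 in \<open>auto intro!: mult_le_one simp: abs_mult\<close>)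
      ultimately show "norm (K z) \<le> 1" by simp
    qed
  qed simp
  define c where "c = integral\<^sup>L (M \<Otimes>\<^sub>M M) K"
  have K_const: "AE z in M \<Otimes>\<^sub>M M. K z = c"
    unfolding c_def
  proof (rule ergodic_invariant_const[OF preserving_pair[OF pM pM] eM K_int])
    fix t
    let ?P = "\<lambda>x. AE y in N. a (T t x) (S t y) = a x y"
    have "AE z in M \<Otimes>\<^sub>M M. ?P (fst z)" "AE z in M \<Otimes>\<^sub>M M. ?P (snd z)"
      by (intro AE_pair_fstI AE_pair_sndI ainv M.prob_space_axioms M.sigma_finite_measure_axioms)+
    then show "AE z in M \<Otimes>\<^sub>M M. K (pair_flow T T t z) = K z"
      using AE_space
    proof eventually_elim
      case (elim z)
      then have [measurable]: "fst z \<in> space M" "snd z \<in> space M" by (auto simp: space_pair_measure)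
      then have [measurable]: "T t (fst z) \<in> space M" "T t (snd z) \<in> space M"
        using measurable_space[OF T] by auto
      have "K (pair_flow T T t z) = (\<integral>y. a (T t (fst z)) y * a (T t (snd z)) y \<partial>distr N N (S t))"
        by (simp add: K_def pair_flow_def dS)
      also have "\<dots> = (\<integral>y. a (T t (fst z)) (S t y) * a (T t (snd z)) (S t y) \<partial>N)"
        by (rule integral_distr) measurable
      also have "\<dots> = K z" unfolding K_def
        by (rule integral_cong_AE, measurable) (use elim(1,2) in \<open>eventually_elim, simp\<close>)
      finally show ?case .
    qed
  qed

  define m where "m = measure (M \<Otimes>\<^sub>M N) A"
  have a_int: "integrable (M \<Otimes>\<^sub>M N) (\<lambda>z. a (fst z) (snd z))"
    by (rule MN.P.integrable_const_bound[of _ 1]) (use a01 in auto)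
  have m_a: "m = (\<integral>z. a (fst z) (snd z) \<partial>(M \<Otimes>\<^sub>M N))"
    by (simp add: m_def a_def)
  define u where "u x = (\<integral>y. a x y \<partial>N)" for x
  have [measurable]: "u \<in> borel_measurable M" unfolding u_def by measurable
  have u_int: "integrable M u" and u_m: "integral\<^sup>L M u = m"
    using MN.integrable_fst'[OF a_int] MN.integral_fst'[OF a_int] by (simp_all add: u_def[abs_def] m_a)
  have u_const: "AE x in M. u x = m"
    unfolding u_m[symmetric]
  proof (rule ergodic_invariant_const[OF pM eT u_int])
    fix t
    show "AE x in M. u (T t x) = u x"
      using ainv[of t] AE_space
    proof eventually_elim
      case (elim x)
      then have [measurable]: "x \<in> space M" "T t x \<in> space M" using measurable_space[OF T] by auto
      have "u (T t x) = (\<integral>y. a (T t x) y \<partial>distr N N (S t))" by (simp add: u_def dS)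
      also have "\<dots> = (\<integral>y. a (T t x) (S t y) \<partial>N)" by (rule integral_distr) measurable
      also have "\<dots> = u x" unfolding u_def
        by (rule integral_cong_AE, measurable) (use elim(1) in auto)
      finally show ?case .
    qed
  qed

  define v where "v B y = (\<integral>x. a x y * indicator B x \<partial>M)" for B y
  have v_meas[measurable]: "v B \<in> borel_measurable N" if [measurable]: "B \<in> sets M" for B
    unfolding v_def by measurable
  have ai_int: "integrable M (\<lambda>x. a x y * indicator B x)" if [measurable]: "B \<in> sets M" "y \<in> space N" for B y
    by (rule M.integrable_const_bound[of _ 1]) (use a01 in \<open>auto simp: abs_mult indicator_def\<close>)
  have v01: "0 \<le> v B y" "v B y \<le> 1" if "B \<in> sets M" "y \<in> space N" for B y
    unfolding v_def using a01 ai_int[OF that]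
    by (auto intro!: integral_nonneg_AE M.integral_le_const simp: indicator_def)
  have v_int: "integrable N (v B)" if [measurable]: "B \<in> sets M" for B
    by (rule N.integrable_const_bound[of _ 1]) (use v01[OF that] in auto)
  have v2_int: "integrable N (\<lambda>y. (v B y)\<^sup>2)" if [measurable]: "B \<in> sets M" for B
    by (rule N.integrable_const_bound[of _ 1])
       (use v01[OF that] in \<open>auto simp: power_le_one abs_le_iff\<close>)

  have v2: "(\<integral>y. (v B y)\<^sup>2 \<partial>N) = c * (measure M B)\<^sup>2" if B[measurable]: "B \<in> sets M" for B
  proof -
    let ?F = "\<lambda>z y. (a (fst z) y * indicator B (fst z)) * (a (snd z) y * indicator B (snd z))"
    have F_int: "integrable ((M \<Otimes>\<^sub>M M) \<Otimes>\<^sub>M N) (case_prod ?F)"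
      by (rule MMN.P.integrable_const_bound[of _ 1])
         (use a01 in \<open>auto simp: abs_mult indicator_def split_beta' intro!: mult_le_one\<close>)
    have "(\<integral>y. (v B y)\<^sup>2 \<partial>N) = (\<integral>y. (\<integral>z. ?F z y \<partial>(M \<Otimes>\<^sub>M M)) \<partial>N)"
    proof (rule Bochner_Integration.integral_cong[OF refl])
      fix y assume y[measurable]: "y \<in> space N"
      have "integrable (M \<Otimes>\<^sub>M M) (\<lambda>z. ?F z y)"
        by (rule MM.P.integrable_const_bound[of _ 1])
           (use a01 in \<open>auto simp: abs_mult indicator_def intro!: mult_le_one\<close>)
      from MM.integral_fst'[OF this] show "(v B y)\<^sup>2 = (\<integral>z. ?F z y \<partial>(M \<Otimes>\<^sub>M M))"
        by (simp add: v_def power2_eq_square)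
    qed
    also have "\<dots> = (\<integral>z. (\<integral>y. ?F z y \<partial>N) \<partial>(M \<Otimes>\<^sub>M M))"
      using MMN.Fubini_integral[OF F_int] by simp
    also have "\<dots> = (\<integral>z. K z * indicator (B \<times> B) z \<partial>(M \<Otimes>\<^sub>M M))"
      by (rule Bochner_Integration.integral_cong[OF refl])
         (auto simp: K_def indicator_def mem_Times_iff)
    also have "\<dots> = (\<integral>z. c * indicator (B \<times> B) z \<partial>(M \<Otimes>\<^sub>M M))"
      by (intro integral_cong_AE borel_measurable_times K_meas borel_measurable_indicator
            borel_measurable_const pair_measureI B) (use K_const in \<open>eventually_elim, simp\<close>)
    also have "\<dots> = c * (measure M B)\<^sup>2"
      by (simp add: measure_pair_Times[OF M.sigma_finite_measure_axioms] power2_eq_square)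
    finally show ?thesis .
  qed

  have v1: "(\<integral>y. v B y \<partial>N) = m * measure M B" if B[measurable]: "B \<in> sets M" for B
  proof -
    have F_int: "integrable (M \<Otimes>\<^sub>M N) (\<lambda>(x, y). a x y * indicator B x)"
      by (rule MN.P.integrable_const_bound[of _ 1])
         (use a01 in \<open>auto simp: abs_mult indicator_def\<close>)
    have "(\<integral>y. v B y \<partial>N) = (\<integral>x. (\<integral>y. a x y * indicator B x \<partial>N) \<partial>M)"
      unfolding v_def by (rule MN.Fubini_integral[OF F_int])
    also have "\<dots> = (\<integral>x. u x * indicator B x \<partial>M)" by (simp add: u_def)
    also have "\<dots> = (\<integral>x. m * indicator B x \<partial>M)"
      by (rule integral_cong_AE, measurable) (use u_const in \<open>eventually_elim, simp\<close>)
    finally show ?thesis by simp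
  qed

  \<comment> \<open>For the whole space the function \<open>v\<close> is \<open>S\<close>-invariant, which identifies \<open>c\<close>.\<close>
  have "AE y in N. v (space M) y = integral\<^sup>L N (v (space M))"
  proof (rule ergodic_invariant_const[OF pN eN v_int[OF sets.top]])
    fix t
    have "AE y in N. AE x in M. a (T t x) (S t y) = a x y"
      using ainv[of t] by (subst (asm) MN.AE_commute) simp_all
    then show "AE y in N. v (space M) (S t y) = v (space M) y"
      using AE_space
    proof eventually_elim
      case (elim y)
      then have [measurable]: "y \<in> space N" "S t y \<in> space N" using measurable_space[OF S] by auto
      have "v (space M) (S t y) = (\<integral>x. a x (S t y) \<partial>distr M M (T t))"
        by (auto simp: v_def dT intro!: Bochner_Integration.integral_cong)
      also have "\<dots> = (\<integral>x. a (T t x) (S t y) \<partial>M)" by (rule integral_distr) measurable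
      also have "\<dots> = v (space M) y" unfolding v_def
        by (rule integral_cong_AE, measurable)
           (use elim(1) AE_space[of M] in \<open>eventually_elim, simp\<close>)
      finally show ?case .
    qed
  qed
  then have "AE y in N. v (space M) y = m" by (simp add: v1 M.prob_space)
  then have "(\<integral>y. (v (space M) y)\<^sup>2 \<partial>N) = (\<integral>y. m\<^sup>2 \<partial>N)"
    by (intro integral_cong_AE) auto
  then have c: "c = m\<^sup>2" by (simp add: v2 M.prob_space N.prob_space)

  have v_const: "AE y in N. v B y = m * measure M B" if B[measurable]: "B \<in> sets M" for B
  proof -
    let ?k = "m * measure M B"
    have eq: "(v B y - ?k)\<^sup>2 = (v B y)\<^sup>2 - 2 * ?k * v B y + ?k\<^sup>2" for y
      by (simp add: power2_eq_square algebra_simps)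
    have int: "integrable N (\<lambda>y. (v B y - ?k)\<^sup>2)"
      unfolding eq using v_int[OF B] v2_int[OF B] by simp
    have "(\<integral>y. (v B y - ?k)\<^sup>2 \<partial>N) = c * (measure M B)\<^sup>2 - 2 * ?k * ?k + ?k\<^sup>2"
      unfolding eq using v_int[OF B] v2_int[OF B] by (simp add: v1 v2 N.prob_space)
    also have "\<dots> = 0" by (simp add: c power2_eq_square)
    finally have "AE y in N. (v B y - ?k)\<^sup>2 = 0"
      by (subst (asm) integral_nonneg_eq_0_iff_AE[OF int]) auto
    then show ?thesis by simp
  qed

  have rect: "measure (M \<Otimes>\<^sub>M N) (A \<inter> (B \<times> C)) = m * measure (M \<Otimes>\<^sub>M N) (B \<times> C)"
    if [measurable]: "B \<in> sets M" "C \<in> sets N" for B C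
  proof -
    have F_int: "integrable (M \<Otimes>\<^sub>M N) (\<lambda>(x, y). a x y * indicator B x * indicator C y)"
      by (rule MN.P.integrable_const_bound[of _ 1])
         (use a01 in \<open>auto simp: abs_mult indicator_def\<close>)
    have "measure (M \<Otimes>\<^sub>M N) (A \<inter> (B \<times> C)) = (\<integral>z. indicator (A \<inter> (B \<times> C)) z \<partial>(M \<Otimes>\<^sub>M N))"
      by simp
    also have "\<dots> = (\<integral>z. (case z of (x, y) \<Rightarrow> a x y * indicator B x * indicator C y) \<partial>(M \<Otimes>\<^sub>M N))"
      by (rule Bochner_Integration.integral_cong[OF refl]) (auto simp: a_def indicator_def)
    also have "\<dots> = (\<integral>y. v B y * indicator C y \<partial>N)"
      unfolding MN.integral_snd[OF F_int, symmetric] v_def by simp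
    also have "\<dots> = (\<integral>y. m * measure M B * indicator C y \<partial>N)"
      by (rule integral_cong_AE, measurable) (use v_const[OF that(1)] in auto)
    also have "\<dots> = m * measure (M \<Otimes>\<^sub>M N) (B \<times> C)"
      by (simp add: measure_pair_Times[OF N.sigma_finite_measure_axioms])
    finally show ?thesis .
  qed

  have "measure (M \<Otimes>\<^sub>M N) (A \<inter> D) = m * measure (M \<Otimes>\<^sub>M N) D" if "D \<in> sets (M \<Otimes>\<^sub>M N)" for D
    using that unfolding sets_pair_measure
  proof (induction rule: sigma_sets_induct_disjoint[OF Int_stable_pair_measure_generator pair_measure_closed, consumes 1, case_names basic empty compl union])
    case (basic D)
    then show ?case using rect by auto
  next
    case empty
    then show ?case by simp
  next
    case (compl D)
    then have D[measurable]: "D \<in> sets (M \<Otimes>\<^sub>M N)" by (simp add: sets_pair_measure)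
    have "A \<inter> (space M \<times> space N - D) = A - A \<inter> D"
      using sets.sets_into_space[OF A] by (auto simp: space_pair_measure)
    moreover have "measure (M \<Otimes>\<^sub>M N) (A - A \<inter> D) = m - m * measure (M \<Otimes>\<^sub>M N) D"
      using compl(2) by (simp add: MN.P.finite_measure_Diff m_def)
    moreover have "measure (M \<Otimes>\<^sub>M N) (space M \<times> space N - D) = 1 - measure (M \<Otimes>\<^sub>M N) D"
      using MN.P.prob_compl[OF D] by (simp add: space_pair_measure)
    ultimately show ?case by (simp only: right_diff_distrib mult_1_right)
  next
    case (union D)
    then have D: "range D \<subseteq> sets (M \<Otimes>\<^sub>M N)" by (simp add: sets_pair_measure)
    have "(\<lambda>i. measure (M \<Otimes>\<^sub>M N) (A \<inter> D i)) sums measure (M \<Otimes>\<^sub>M N) (\<Union>i. A \<inter> D i)"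
      using D union(1) by (intro MN.P.finite_measure_UNION) (auto simp: disjoint_family_on_def)
    moreover have "(\<lambda>i. m * measure (M \<Otimes>\<^sub>M N) (D i)) sums (m * measure (M \<Otimes>\<^sub>M N) (\<Union>i. D i))"
      by (intro sums_mult MN.P.finite_measure_UNION D union(1))
    ultimately show ?case using union(3) by (simp add: sums_iff)
  qed
  from this[OF A] have "m = m * m" by (simp add: m_def)
  then show "measure (M \<Otimes>\<^sub>M N) A = 0 \<or> measure (M \<Otimes>\<^sub>M N) A = 1"
    by (auto simp: m_def)
qed

section \<open>Continuity in mean\<close>

text \<open>
  Continuity at time zero of the orbit of \<open>f\<close> in \<open>L\<^sup>1\<close>. It follows for all integrable \<open>f\<close> from the
  case of indicators, where it is inherited by products and is equivalent to the weak
  \<open>L\<^sup>2\<close>-continuity required of a flow.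
\<close>

definition L1_continuous :: "'a measure \<Rightarrow> (real \<Rightarrow> 'a \<Rightarrow> 'a) \<Rightarrow> ('a \<Rightarrow> real) \<Rightarrow> bool" where
  "L1_continuous M T f \<longleftrightarrow>
     integrable M f \<and> ((\<lambda>t. \<integral>x. \<bar>f (T t x) - f x\<bar> \<partial>M) \<longlongrightarrow> 0) (at 0)"

lemma preserving_integrable:
  fixes f :: "'a \<Rightarrow> 'b::{banach, second_countable_topology}"
  assumes "preserving M T" "integrable M f"
  shows "integrable M (\<lambda>x. f (T t x))"
proof -
  have *: "T t \<in> measurable M M" "distr M M (T t) = M" using assms by (auto simp: preserving_def)
  show ?thesis
    using integrable_distr_eq[OF *(1), of f] assms(2) by (simp add: *(2) borel_measurable_integrable)
qed

lemma preserving_integral: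
  fixes f :: "'a \<Rightarrow> 'b::{banach, second_countable_topology}"
  assumes "preserving M T" "f \<in> borel_measurable M"
  shows "(\<integral>x. f (T t x) \<partial>M) = integral\<^sup>L M f"
proof -
  have *: "T t \<in> measurable M M" "distr M M (T t) = M" using assms by (auto simp: preserving_def)
  show ?thesis using integral_distr[OF *(1), of f] assms(2) by (simp add: *(2))
qed

lemma L1_continuous_approx:
  assumes T: "preserving M T" and f: "integrable M f"
    and approx: "\<And>e. e > 0 \<Longrightarrow> \<exists>g. L1_continuous M T g \<and> (\<integral>x. \<bar>f x - g x\<bar> \<partial>M) < e"
  shows "L1_continuous M T f"
  unfolding L1_continuous_def
proof (intro conjI tendstoI f)
  fix e :: real assume e: "e > 0"
  obtain g where g: "L1_continuous M T g" and fg: "(\<integral>x. \<bar>f x - g x\<bar> \<partial>M) < e / 3"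
    using approx[of "e / 3"] e by auto
  have gi: "integrable M g" and "((\<lambda>t. \<integral>x. \<bar>g (T t x) - g x\<bar> \<partial>M) \<longlongrightarrow> 0) (at 0)"
    using g by (auto simp: L1_continuous_def)
  then have "\<forall>\<^sub>F t in at 0. dist (\<integral>x. \<bar>g (T t x) - g x\<bar> \<partial>M) 0 < e / 3"
    using e by (intro tendstoD) auto
  then show "\<forall>\<^sub>F t in at 0. dist (\<integral>x. \<bar>f (T t x) - f x\<bar> \<partial>M) 0 < e"
  proof eventually_elim
    case (elim t)
    note int = f gi preserving_integrable[OF T f, of t] preserving_integrable[OF T gi, of t]
    have "(\<integral>x. \<bar>f (T t x) - f x\<bar> \<partial>M) \<le>
        (\<integral>x. \<bar>f (T t x) - g (T t x)\<bar> + \<bar>g (T t x) - g x\<bar> + \<bar>f x - g x\<bar> \<partial>M)"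
      using int by (intro integral_mono) auto
    also have "\<dots> = (\<integral>x. \<bar>f (T t x) - g (T t x)\<bar> \<partial>M) + (\<integral>x. \<bar>g (T t x) - g x\<bar> \<partial>M) + (\<integral>x. \<bar>f x - g x\<bar> \<partial>M)"
      using int by simp
    also have "(\<integral>x. \<bar>f (T t x) - g (T t x)\<bar> \<partial>M) = (\<integral>x. \<bar>f x - g x\<bar> \<partial>M)"
      using f gi by (intro preserving_integral[OF T, of "\<lambda>x. \<bar>f x - g x\<bar>"]) auto
    finally show ?case using fg elim by (simp add: dist_real_def)
  qed
qed

lemma L1_continuous_limit:
  assumes T: "preserving M T" and s: "\<And>i. L1_continuous M T (s i)"
    and lim: "\<And>x. x \<in> space M \<Longrightarrow> (\<lambda>i. s i x) \<longlonglongrightarrow> f x"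
    and bound: "\<And>i x. x \<in> space M \<Longrightarrow> \<bar>s i x\<bar> \<le> w x" and w: "integrable M w"
    and f: "integrable M f"
  shows "L1_continuous M T f"
proof (rule L1_continuous_approx[OF T f])
  fix e :: real assume e: "e > 0"
  have si: "integrable M (s i)" for i using s by (simp add: L1_continuous_def)
  note [measurable] = borel_measurable_integrable[OF si] borel_measurable_integrable[OF f]
  have "(\<lambda>i. \<integral>x. \<bar>f x - s i x\<bar> \<partial>M) \<longlonglongrightarrow> (\<integral>x. 0 \<partial>M)"
  proof (rule integral_dominated_convergence)
    show "integrable M (\<lambda>x. \<bar>f x\<bar> + w x)" using f w by auto
    show "AE x in M. (\<lambda>i. \<bar>f x - s i x\<bar>) \<longlonglongrightarrow> 0"
    proof (rule AE_I2)
      fix x assume "x \<in> space M"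
      from tendsto_diff[OF tendsto_const lim[OF this], of "f x"]
      show "(\<lambda>i. \<bar>f x - s i x\<bar>) \<longlonglongrightarrow> 0" by (auto intro: tendsto_rabs_zero)
    qed
    show "AE x in M. norm \<bar>f x - s i x\<bar> \<le> \<bar>f x\<bar> + w x" for i
    proof (rule AE_I2)
      fix x assume "x \<in> space M"
      from bound[OF this, of i] show "norm \<bar>f x - s i x\<bar> \<le> \<bar>f x\<bar> + w x" by auto
    qed
  qed auto
  then have "\<forall>\<^sub>F i in sequentially. dist (\<integral>x. \<bar>f x - s i x\<bar> \<partial>M) 0 < e"
    using e by (intro tendstoD) auto
  then obtain i where "dist (\<integral>x. \<bar>f x - s i x\<bar> \<partial>M) 0 < e"
    by (auto simp: eventually_sequentially)
  then show "\<exists>g. L1_continuous M T g \<and> (\<integral>x. \<bar>f x - g x\<bar> \<partial>M) < e"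
    using s[of i] by (auto simp: dist_real_def)
qed

lemma L1_continuous_dominated:
  assumes f: "integrable M f"
    and "\<And>t. (\<integral>x. \<bar>f (T t x) - f x\<bar> \<partial>M) \<le> h t" "(h \<longlongrightarrow> 0) (at 0)"
  shows "L1_continuous M T f"
  unfolding L1_continuous_def
  by (intro conjI f tendsto_sandwich[OF _ _ tendsto_const assms(3)] always_eventually allI assms(2))
     auto

lemma L1_continuous_add:
  assumes T: "preserving M T" and f: "L1_continuous M T f" and g: "L1_continuous M T g"
  shows "L1_continuous M T (\<lambda>x. f x + g x)"
proof (rule L1_continuous_dominated)
  have fi: "integrable M f" and gi: "integrable M g" using f g by (auto simp: L1_continuous_def)
  then show "integrable M (\<lambda>x. f x + g x)" by simp
  note int = fi gi preserving_integrable[OF T fi] preserving_integrable[OF T gi]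
  show "(\<integral>x. \<bar>f (T t x) + g (T t x) - (f x + g x)\<bar> \<partial>M) \<le>
      (\<integral>x. \<bar>f (T t x) - f x\<bar> \<partial>M) + (\<integral>x. \<bar>g (T t x) - g x\<bar> \<partial>M)" for t
  proof -
    have "(\<integral>x. \<bar>f (T t x) + g (T t x) - (f x + g x)\<bar> \<partial>M) \<le>
        (\<integral>x. \<bar>f (T t x) - f x\<bar> + \<bar>g (T t x) - g x\<bar> \<partial>M)"
      using int by (intro integral_mono) auto
    then show ?thesis using int by simp
  qed
  show "((\<lambda>t. (\<integral>x. \<bar>f (T t x) - f x\<bar> \<partial>M) + (\<integral>x. \<bar>g (T t x) - g x\<bar> \<partial>M)) \<longlongrightarrow> 0) (at 0)"
    using f g by (intro tendsto_add_zero) (auto simp: L1_continuous_def)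
qed

lemma L1_continuous_cmult:
  assumes f: "L1_continuous M T f"
  shows "L1_continuous M T (\<lambda>x. f x * c)"
proof (rule L1_continuous_dominated)
  show "integrable M (\<lambda>x. f x * c)" using f by (simp add: L1_continuous_def)
  show "(\<integral>x. \<bar>f (T t x) * c - f x * c\<bar> \<partial>M) \<le> (\<integral>x. \<bar>f (T t x) - f x\<bar> \<partial>M) * \<bar>c\<bar>" for t
    by (simp add: abs_mult flip: left_diff_distrib)
  show "((\<lambda>t. (\<integral>x. \<bar>f (T t x) - f x\<bar> \<partial>M) * \<bar>c\<bar>) \<longlongrightarrow> 0) (at 0)"
    using f by (intro tendsto_mult_left_zero) (auto simp: L1_continuous_def)
qed

lemma L1_continuous_if_indicators:
  assumes T: "preserving M T" and ind: "\<And>A. A \<in> sets M \<Longrightarrow> L1_continuous M T (indicator A)"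
    and "integrable M f"
  shows "L1_continuous M T f"
  using \<open>integrable M f\<close>
proof (induction rule: integrable_induct)
  case (base A c)
  then show ?case using L1_continuous_cmult[OF ind[of A], of c] by simp
next
  case (add f g)
  then show ?case by (intro L1_continuous_add[OF T])
next
  case (lim f s)
  show ?case
    by (rule L1_continuous_limit[OF T lim.IH, where w = "\<lambda>x. 2 * \<bar>f x\<bar>"]) (use lim.hyps in auto)
qed

lemma indicator_L2: "prob_space M \<Longrightarrow> A \<in> sets M \<Longrightarrow> (indicator A :: 'a \<Rightarrow> complex) \<in> L2_fun M"
  unfolding L2_fun_def
  by (auto intro!: finite_measure.integrable_const_bound[of _ _ 1] prob_space.finite_measure
      simp: indicator_def split: if_splits)

lemma flow_L1_continuous_indicator:
  assumes "flow M T" and A[measurable]: "A \<in> sets M"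
  shows "L1_continuous M T (indicator A)"
proof -
  interpret flow M T by fact
  note T = flow_preserving[OF assms(1)]
  note [measurable] = measurable_flow
  have int: "integrable M (indicator A :: 'a \<Rightarrow> real)"
    by (simp add: emeasure_eq_measure)
  define F where "F t = (LINT x|M. indicator A (T t x) * cnj (indicator A x :: complex))" for t
  have "continuous_on UNIV F"
    unfolding F_def by (intro flow_continuous indicator_L2 A prob_space_axioms)
  then have "(F \<longlongrightarrow> F 0) (at 0)"
    by (simp add: continuous_on_eq_continuous_at isContD)
  then have lim: "((\<lambda>t. 2 * prob A - 2 * Re (F t)) \<longlongrightarrow> 2 * prob A - 2 * Re (F 0)) (at 0)"
    by (intro tendsto_intros)
  have F: "F t = complex_of_real (\<integral>x. indicator A (T t x) * indicator A x \<partial>M)" for t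
    unfolding F_def integral_complex_of_real[symmetric]
    by (rule Bochner_Integration.integral_cong) (auto simp: indicator_def)
  have F0: "Re (F 0) = prob A"
  proof -
    have "(\<integral>x. indicator A (T 0 x) * indicator A x \<partial>M) = (\<integral>x. indicator A x \<partial>M :: real)"
      by (rule Bochner_Integration.integral_cong) (auto simp: flow_zero indicator_def)
    then show ?thesis by (simp add: F)
  qed
  show ?thesis
  proof (rule L1_continuous_dominated[OF int])
    fix t
    have i2: "integrable M (\<lambda>x. indicator A (T t x) * indicator A x :: real)"
      by (rule integrable_const_bound[of _ 1]) (auto simp: indicator_def)
    have i1: "integrable M (\<lambda>x. indicator A (T t x) :: real)"
      by (rule preserving_integrable[OF T int])
    \<comment> \<open>For \<open>a, b \<in> {0, 1}\<close> one has \<open>\<bar>a - b\<bar> = a + b - 2 * (a * b)\<close>.\<close>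
    have "(\<integral>x. \<bar>indicator A (T t x) - indicator A x\<bar> \<partial>M :: real) =
        (\<integral>x. indicator A (T t x) + indicator A x - 2 * (indicator A (T t x) * indicator A x) \<partial>M)"
      by (rule Bochner_Integration.integral_cong) (auto simp: indicator_def)
    also have "\<dots> = (\<integral>x. indicator A (T t x) \<partial>M) + prob A - 2 * Re (F t)"
      using int i1 i2 by (simp add: F)
    also have "(\<integral>x. indicator A (T t x) \<partial>M :: real) = prob A"
      using preserving_integral[OF T, of "indicator A :: 'a \<Rightarrow> real" t] by simp
    finally show "(\<integral>x. \<bar>indicator A (T t x) - indicator A x\<bar> \<partial>M :: real) \<le> 2 * prob A - 2 * Re (F t)"
      by simp
  qed (use lim F0 in simp)
qed

lemma L1_continuous_indicator_pair:
  assumes T: "preserving M T" and S: "preserving N S"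
    and iM: "\<And>A. A \<in> sets M \<Longrightarrow> L1_continuous M T (indicator A)"
    and iN: "\<And>A. A \<in> sets N \<Longrightarrow> L1_continuous N S (indicator A)"
    and D: "D \<in> sets (M \<Otimes>\<^sub>M N)"
  shows "L1_continuous (M \<Otimes>\<^sub>M N) (pair_flow T S) (indicator D)"
proof -
  note TS = preserving_pair[OF T S]
  interpret M: prob_space M using T by (simp add: preserving_def)
  interpret N: prob_space N using S by (simp add: preserving_def)
  interpret MN: pair_prob_space M N ..
  have [measurable]: "T t \<in> measurable M M" "S t \<in> measurable N N" for t
    using T S by (auto simp: preserving_def)
  have int: "integrable (M \<Otimes>\<^sub>M N) (indicator D :: _ \<Rightarrow> real)" if "D \<in> sets (M \<Otimes>\<^sub>M N)" for D
    using that by (simp add: MN.P.emeasure_eq_measure)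
  show ?thesis
    using D unfolding sets_pair_measure
  proof (induction rule: sigma_sets_induct_disjoint[OF Int_stable_pair_measure_generator pair_measure_closed, consumes 1, case_names basic empty compl union])
    case (basic D)
    then obtain A B where D: "D = A \<times> B" and A[measurable]: "A \<in> sets M" and B[measurable]: "B \<in> sets N"
      by auto
    let ?hA = "\<lambda>t. \<integral>x. \<bar>indicator A (T t x) - indicator A x\<bar> \<partial>M :: real"
    let ?hB = "\<lambda>t. \<integral>x. \<bar>indicator B (S t x) - indicator B x\<bar> \<partial>N :: real"
    show ?case
    proof (rule L1_continuous_dominated)
      show "integrable (M \<Otimes>\<^sub>M N) (indicator D :: _ \<Rightarrow> real)" by (rule int) (simp add: D)
      fix t
      have [measurable]: "(\<lambda>x. \<bar>indicator A (T t x) - indicator A x\<bar> :: real) \<in> borel_measurable M"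
        "(\<lambda>x. \<bar>indicator B (S t x) - indicator B x\<bar> :: real) \<in> borel_measurable N" by measurable
      have iA: "integrable (M \<Otimes>\<^sub>M N) (\<lambda>z. \<bar>indicator A (T t (fst z)) - indicator A (fst z)\<bar> :: real)"
        and iB: "integrable (M \<Otimes>\<^sub>M N) (\<lambda>z. \<bar>indicator B (S t (snd z)) - indicator B (snd z)\<bar> :: real)"
        by (rule MN.P.integrable_const_bound[of _ 1]; auto simp: indicator_def)+
      have iT: "integrable (M \<Otimes>\<^sub>M N) (\<lambda>z. \<bar>indicator D (pair_flow T S t z) - indicator D z\<bar> :: real)"
        using preserving_integrable[OF TS int, of D t] int[of D] D by auto
      have "(\<integral>z. \<bar>indicator D (pair_flow T S t z) - indicator D z\<bar> \<partial>(M \<Otimes>\<^sub>M N) :: real) \<le>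
         (\<integral>z. \<bar>indicator A (T t (fst z)) - indicator A (fst z)\<bar> +
               \<bar>indicator B (S t (snd z)) - indicator B (snd z)\<bar> \<partial>(M \<Otimes>\<^sub>M N))"
        using iA iB iT by (intro integral_mono) (auto simp: D pair_flow_def indicator_def)
      also have "\<dots> = (\<integral>z. \<bar>indicator A (T t (fst z)) - indicator A (fst z)\<bar> \<partial>(M \<Otimes>\<^sub>M N)) +
          (\<integral>z. \<bar>indicator B (S t (snd z)) - indicator B (snd z)\<bar> \<partial>(M \<Otimes>\<^sub>M N))"
        using iA iB by simp
      also have "(\<integral>z. \<bar>indicator A (T t (fst z)) - indicator A (fst z)\<bar> \<partial>(M \<Otimes>\<^sub>M N) :: real) = ?hA t"
        using integral_distr[of fst "M \<Otimes>\<^sub>M N" M "\<lambda>x. \<bar>indicator A (T t x) - indicator A x\<bar> :: real"]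
        by (simp add: distr_pair_fst M.sigma_finite_measure_axioms N.prob_space_axioms)
      also have "(\<integral>z. \<bar>indicator B (S t (snd z)) - indicator B (snd z)\<bar> \<partial>(M \<Otimes>\<^sub>M N) :: real) = ?hB t"
        using integral_distr[of snd "M \<Otimes>\<^sub>M N" N "\<lambda>x. \<bar>indicator B (S t x) - indicator B x\<bar> :: real"]
        by (simp add: distr_pair_snd N.sigma_finite_measure_axioms M.prob_space_axioms)
      finally show "(\<integral>z. \<bar>indicator D (pair_flow T S t z) - indicator D z\<bar> \<partial>(M \<Otimes>\<^sub>M N) :: real) \<le> ?hA t + ?hB t" .
    next
      show "((\<lambda>t. ?hA t + ?hB t) \<longlongrightarrow> 0) (at 0)"
        using iM[OF A] iN[OF B] by (intro tendsto_add_zero) (auto simp: L1_continuous_def)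
    qed
  next
    case empty
    then show ?case by (simp add: L1_continuous_def)
  next
    case (compl D)
    then have D: "D \<in> sets (M \<Otimes>\<^sub>M N)" by (simp add: sets_pair_measure)
    have "L1_continuous (M \<Otimes>\<^sub>M N) (pair_flow T S) (\<lambda>z. 1 + indicator D z * (-1))"
      by (intro L1_continuous_add[OF TS] L1_continuous_cmult compl(2)) (simp add: L1_continuous_def)
    moreover have "(\<integral>z. \<bar>indicator (space M \<times> space N - D) (pair_flow T S t z) - indicator (space M \<times> space N - D) z\<bar> \<partial>(M \<Otimes>\<^sub>M N)) =
      (\<integral>z. \<bar>(1 + indicator D (pair_flow T S t z) * (-1)) - (1 + indicator D z * (-1))\<bar> \<partial>(M \<Otimes>\<^sub>M N) :: real)" for t
    proof (rule Bochner_Integration.integral_cong[OF refl])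
      fix z assume z: "z \<in> space (M \<Otimes>\<^sub>M N)"
      then have "pair_flow T S t z \<in> space (M \<Otimes>\<^sub>M N)"
        using TS by (auto simp: preserving_def intro: measurable_space)
      with z show "\<bar>indicator (space M \<times> space N - D) (pair_flow T S t z) - indicator (space M \<times> space N - D) z\<bar> =
        \<bar>(1 + indicator D (pair_flow T S t z) * (-1)) - (1 + indicator D z * (-1)) :: real\<bar>"
        by (auto simp: indicator_def space_pair_measure)
    qed
    moreover have "space M \<times> space N - D \<in> sets (M \<Otimes>\<^sub>M N)"
      using D by (metis sets.compl_sets space_pair_measure)
    ultimately show ?case using int unfolding L1_continuous_def by simp
  next
    case (union D)
    then have D: "D i \<in> sets (M \<Otimes>\<^sub>M N)" for i by (auto simp: sets_pair_measure)
    have fin: "L1_continuous (M \<Otimes>\<^sub>M N) (pair_flow T S) (\<lambda>z. \<Sum>i<n. indicator (D i) z)" for n :: nat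
    proof (induction n)
      case (Suc n)
      then show ?case using L1_continuous_add[OF TS Suc union(3)[of n]] by simp
    qed (simp add: L1_continuous_def)
    have "indicator (\<Union>i<n. D i) = (\<lambda>z. (\<Sum>i<n. indicator (D i) z) :: real)" for n :: nat
      using union(1) by (intro ext indicator_UN_disjoint) (auto intro: disjoint_family_on_mono)
    then have fin': "L1_continuous (M \<Otimes>\<^sub>M N) (pair_flow T S) (indicator (\<Union>i<n. D i))" for n :: nat
      using fin by simp
    have "(\<Union>i. D i) \<in> sets (M \<Otimes>\<^sub>M N)" using D by auto
    then show ?case
      by (intro L1_continuous_limit[where s = "\<lambda>n. indicator (\<Union>i<n. D i)" and w = "\<lambda>_. 1",
            OF TS fin'] LIMSEQ_indicator_UN int)
         (auto simp: indicator_def)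
  qed
qed

lemma L2_integrable_mult:
  assumes "f \<in> L2_fun M" "g \<in> L2_fun M"
  shows "integrable M (\<lambda>x. f x * cnj (g x))"
proof (rule Bochner_Integration.integrable_bound)
  show "integrable M (\<lambda>x. (cmod (f x))\<^sup>2 + (cmod (g x))\<^sup>2)" using assms by (auto simp: L2_fun_def)
  have [measurable]: "cnj \<in> borel_measurable borel"
    by (intro borel_measurable_continuous_onI continuous_intros)
  show "(\<lambda>x. f x * cnj (g x)) \<in> borel_measurable M"
    using assms by (auto simp: L2_fun_def intro!: borel_measurable_times measurable_compose[of g M borel cnj])
  have "r * s \<le> r\<^sup>2 + s\<^sup>2" if "0 \<le> r" "0 \<le> s" for r s :: real
    using that sum_squares_bound[of r s] mult_nonneg_nonneg[of r s] by linarith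
  then show "AE x in M. norm (f x * cnj (g x)) \<le> norm ((cmod (f x))\<^sup>2 + (cmod (g x))\<^sup>2)"
    by (simp add: norm_mult)
qed

lemma L2_diff:
  assumes "f \<in> L2_fun M" "g \<in> L2_fun M"
  shows "(\<lambda>x. f x - g x) \<in> L2_fun M"
proof -
  have [measurable]: "f \<in> borel_measurable M" "g \<in> borel_measurable M" using assms by (auto simp: L2_fun_def)
  have *: "(cmod (a - b))\<^sup>2 \<le> 2 * ((cmod a)\<^sup>2 + (cmod b)\<^sup>2)" for a b
  proof -
    have "(cmod (a - b))\<^sup>2 \<le> (cmod a + cmod b)\<^sup>2" by (intro power_mono norm_triangle_ineq4) simp
    also have "\<dots> \<le> 2 * ((cmod a)\<^sup>2 + (cmod b)\<^sup>2)"
      using sum_squares_bound[of "cmod a" "cmod b"] by (simp add: power2_sum)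
    finally show ?thesis .
  qed
  have "integrable M (\<lambda>x. (cmod (f x - g x))\<^sup>2)"
  proof (rule Bochner_Integration.integrable_bound)
    show "integrable M (\<lambda>x. 2 * ((cmod (f x))\<^sup>2 + (cmod (g x))\<^sup>2))"
      using assms by (auto simp: L2_fun_def)
    show "AE x in M. norm ((cmod (f x - g x))\<^sup>2) \<le> norm (2 * ((cmod (f x))\<^sup>2 + (cmod (g x))\<^sup>2))"
    proof (rule AE_I2)
      fix x
      show "norm ((cmod (f x - g x))\<^sup>2) \<le> norm (2 * ((cmod (f x))\<^sup>2 + (cmod (g x))\<^sup>2))"
        using *[of "f x" "g x"] by (simp only: real_norm_def abs_of_nonneg zero_le_power2
          zero_le_mult_iff add_nonneg_nonneg)
    qed
  qed measurable
  then show ?thesis by (simp add: L2_fun_def)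
qed

text \<open>
  Reduces \<open>L\<^sup>2\<close>-continuity of \<open>f\<close> to \<open>L\<^sup>1\<close>-continuity of the signed squares of its real and
  imaginary parts.
\<close>

lemma square_diff_le_signed_squares:
  fixes r s :: real
  shows "(r - s)\<^sup>2 \<le> 2 * \<bar>r * \<bar>r\<bar> - s * \<bar>s\<bar>\<bar>"
proof -
  have *: "(r - s)\<^sup>2 \<le> 2 * \<bar>r * \<bar>r\<bar> - s * \<bar>s\<bar>\<bar>" if "s \<le> r" for r s :: real
  proof (cases "0 \<le> s \<or> r \<le> 0")
    case True
    then show ?thesis
    proof
      assume s: "0 \<le> s"
      then have "0 \<le> (r - s) * (r + 3 * s)" using that by simp
      moreover have "s * s \<le> r * r" using s that by (intro mult_mono) auto
      ultimately show ?thesis using s that by (simp add: power2_eq_square algebra_simps)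
    next
      assume r: "r \<le> 0"
      then have "0 \<le> (r - s) * (- s - 3 * r)" using that by (intro mult_nonneg_nonneg) auto
      moreover have "r * r \<le> s * s" using r that mult_mono[of "- r" "- s" "- r" "- s"] by simp
      ultimately show ?thesis using r that by (simp add: power2_eq_square algebra_simps)
    qed
  next
    case False
    then have "0 \<le> (r + s) * (r + s)" "0 \<le> r * r + s * s" by simp_all
    with False show ?thesis by (simp add: power2_eq_square algebra_simps)
  qed
  show ?thesis
  proof (cases "s \<le> r")
    case False
    then show ?thesis using *[of r s] by (simp add: power2_commute abs_minus_commute)
  qed (rule *)
qed

lemma L2_continuous:
  assumes T: "preserving M T" and ind: "\<And>A. A \<in> sets M \<Longrightarrow> L1_continuous M T (indicator A)"
    and f: "f \<in> L2_fun M"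
  shows "((\<lambda>t. \<integral>x. (cmod (f (T t x) - f x))\<^sup>2 \<partial>M) \<longlongrightarrow> 0) (at 0)"
proof -
  let ?q = "\<lambda>r :: real. r * \<bar>r\<bar>"
  let ?R = "\<lambda>x. ?q (Re (f x))" and ?I = "\<lambda>x. ?q (Im (f x))"
  have fm[measurable]: "f \<in> borel_measurable M" and f2: "integrable M (\<lambda>x. (cmod (f x))\<^sup>2)"
    using f by (auto simp: L2_fun_def)
  have q: "\<bar>?q (Re z)\<bar> \<le> (cmod z)\<^sup>2" "\<bar>?q (Im z)\<bar> \<le> (cmod z)\<^sup>2" for z
    by (simp_all add: abs_mult cmod_power2 flip: power2_eq_square)
  have iR: "integrable M ?R" and iI: "integrable M ?I"
    by (rule Bochner_Integration.integrable_bound[OF f2]; use q in auto)+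
  have cR: "L1_continuous M T ?R" and cI: "L1_continuous M T ?I"
    by (intro L1_continuous_if_indicators[OF T ind] iR iI; assumption)+
  let ?h = "\<lambda>t. 2 * (\<integral>x. \<bar>?R (T t x) - ?R x\<bar> \<partial>M) + 2 * (\<integral>x. \<bar>?I (T t x) - ?I x\<bar> \<partial>M)"
  have "(?h \<longlongrightarrow> 2 * 0 + 2 * 0) (at 0)"
    using cR cI by (intro tendsto_intros) (auto simp: L1_continuous_def)
  then have h: "(?h \<longlongrightarrow> 0) (at 0)" by simp
  have le: "(\<integral>x. (cmod (f (T t x) - f x))\<^sup>2 \<partial>M) \<le> ?h t" for t
  proof -
    have "(cmod (a - b))\<^sup>2 \<le> 2 * \<bar>?q (Re a) - ?q (Re b)\<bar> + 2 * \<bar>?q (Im a) - ?q (Im b)\<bar>" for a b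
      using square_diff_le_signed_squares[of "Re a" "Re b"] square_diff_le_signed_squares[of "Im a" "Im b"]
      by (simp add: cmod_power2)
    moreover have "(\<lambda>x. f (T t x)) \<in> L2_fun M"
      using preserving_integrable[OF T f2, of t] T by (auto simp: L2_fun_def preserving_def intro: measurable_compose)
    then have "integrable M (\<lambda>x. (cmod (f (T t x) - f x))\<^sup>2)"
      using L2_diff[OF _ f] by (simp add: L2_fun_def)
    moreover have i: "integrable M (\<lambda>x. \<bar>?R (T t x) - ?R x\<bar>)" "integrable M (\<lambda>x. \<bar>?I (T t x) - ?I x\<bar>)"
      using preserving_integrable[OF T iR, of t] preserving_integrable[OF T iI, of t] iR iI by auto
    ultimately have "(\<integral>x. (cmod (f (T t x) - f x))\<^sup>2 \<partial>M) \<le>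
        (\<integral>x. 2 * \<bar>?R (T t x) - ?R x\<bar> + 2 * \<bar>?I (T t x) - ?I x\<bar> \<partial>M)"
      by (intro integral_mono) auto
    also have "\<dots> = ?h t" using i by simp
    finally show ?thesis .
  qed
  show ?thesis
    by (rule tendsto_sandwich[OF _ _ tendsto_const h]) (use le in \<open>auto intro!: always_eventually\<close>)
qed

text \<open>
  Strong \<open>L\<^sup>2\<close>-continuity at time zero, shifted to an arbitrary time \<open>s\<close> by the group law, gives
  weak continuity; the product of two functions is estimated by
  \<open>a * b \<le> a\<^sup>2 / (2 * \<delta>) + \<delta> * b\<^sup>2 / 2\<close>.
\<close>

lemma weak_L2_continuous:
  assumes T: "preserving M T" and add: "\<And>s t x. x \<in> space M \<Longrightarrow> T (s + t) x = T s (T t x)"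
    and ind: "\<And>A. A \<in> sets M \<Longrightarrow> L1_continuous M T (indicator A)"
    and f: "f \<in> L2_fun M" and g: "g \<in> L2_fun M"
  shows "continuous_on UNIV (\<lambda>t. LINT x|M. f (T t x) * cnj (g x))"
proof -
  have Tf: "(\<lambda>x. f (T t x)) \<in> L2_fun M" if f: "f \<in> L2_fun M" for f t
    using preserving_integrable[OF T, of "\<lambda>x. (cmod (f x))\<^sup>2" t] that T
    by (auto simp: L2_fun_def preserving_def intro: measurable_compose)
  let ?F = "\<lambda>t. LINT x|M. f (T t x) * cnj (g x)"
  have "((\<lambda>h. ?F (s + h)) \<longlongrightarrow> ?F s) (at 0)" for s
  proof (rule tendstoI)
    fix e :: real assume e: "e > 0"
    define G where "G = (\<integral>x. (cmod (g x))\<^sup>2 \<partial>M)"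
    have G0: "G \<ge> 0" unfolding G_def by (intro integral_nonneg_AE) auto
    define \<delta> where "\<delta> = e / (G + 1)"
    have \<delta>: "\<delta> > 0" "\<delta> * G < e" using e G0 by (auto simp: \<delta>_def field_simps)
    define k where "k = (\<lambda>x. f (T s x))"
    have k: "k \<in> L2_fun M" unfolding k_def by (rule Tf[OF f])
    have "\<forall>\<^sub>F h in at 0. dist (\<integral>x. (cmod (k (T h x) - k x))\<^sup>2 \<partial>M) 0 < \<delta> * e"
      using \<delta> e by (intro tendstoD[OF L2_continuous[OF T ind k]]) auto
    then show "\<forall>\<^sub>F h in at 0. dist (?F (s + h)) (?F s) < e"
    proof eventually_elim
      case (elim h)
      let ?u = "\<lambda>x. k (T h x) - k x"
      have u: "?u \<in> L2_fun M" by (intro L2_diff Tf k)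
      have "?F (s + h) = (LINT x|M. k (T h x) * cnj (g x))"
        unfolding k_def by (rule Bochner_Integration.integral_cong) (auto simp: add)
      then have "?F (s + h) - ?F s = (LINT x|M. ?u x * cnj (g x))"
        using L2_integrable_mult[OF Tf[OF k] g] L2_integrable_mult[OF k g]
        by (simp add: left_diff_distrib k_def)
      also have "cmod \<dots> \<le> (\<integral>x. cmod (?u x * cnj (g x)) \<partial>M)" by (rule integral_norm_bound)
      also have "\<dots> \<le> (\<integral>x. (1 / (2 * \<delta>)) * (cmod (?u x))\<^sup>2 + (\<delta> / 2) * (cmod (g x))\<^sup>2 \<partial>M)"
      proof (rule integral_mono)
        fix x
        have "0 \<le> (cmod (?u x) - \<delta> * cmod (g x))\<^sup>2 / (2 * \<delta>)" using \<delta> by simp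
        also have "\<dots> = (1 / (2 * \<delta>)) * (cmod (?u x))\<^sup>2 + (\<delta> / 2) * (cmod (g x))\<^sup>2 - cmod (?u x) * cmod (g x)"
          using \<delta> by (simp add: field_simps power2_eq_square)
        finally show "cmod (?u x * cnj (g x)) \<le> (1 / (2 * \<delta>)) * (cmod (?u x))\<^sup>2 + (\<delta> / 2) * (cmod (g x))\<^sup>2"
          by (simp add: norm_mult)
      qed (use u g L2_integrable_mult[OF u g] in \<open>auto simp: L2_fun_def\<close>)
      also have "\<dots> = (1 / (2 * \<delta>)) * (\<integral>x. (cmod (?u x))\<^sup>2 \<partial>M) + (\<delta> / 2) * G"
        using u g by (simp add: G_def L2_fun_def)
      also have "\<dots> < (1 / (2 * \<delta>)) * (\<delta> * e) + e / 2"
        using elim \<delta> by (intro add_strict_mono mult_strict_left_mono) (auto simp: dist_real_def)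
      also have "\<dots> = e" using \<delta> by simp
      finally show ?case by (simp add: dist_norm)
    qed
  qed
  then show ?thesis
    by (simp add: continuous_on_eq_continuous_at isCont_iff)
qed

section \<open>Products and isomorphic copies of weakly mixing flows\<close>

lemma weakly_mixing_flow: "weakly_mixing M T \<Longrightarrow> flow M T"
  by (simp add: weakly_mixing_def)

lemma weakly_mixing_preserving: "weakly_mixing M T \<Longrightarrow> preserving M T"
  by (simp add: weakly_mixing_def flow_preserving)

lemma weakly_mixing_ergodic: assumes "weakly_mixing M T" shows "ergodic M T"
proof -
  have T: "preserving M T" by (rule weakly_mixing_preserving[OF assms])
  interpret M: prob_space M using T by (simp add: preserving_def)
  interpret MM: pair_prob_space M M ..
  show ?thesis
    by (rule ergodic_factor[OF MM.P.prob_space_axioms, of fst M "pair_flow T T"])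
       (use assms preserving_pair[OF T T] in \<open>auto simp: weakly_mixing_def distr_pair_fst
          M.prob_space_axioms M.sigma_finite_measure_axioms pair_flow_def preserving_def\<close>)
qed

lemma flow_pair:
  assumes "flow M T" "flow N S"
  shows "flow (M \<Otimes>\<^sub>M N) (pair_flow T S)"
proof -
  interpret M: flow M T by fact
  interpret N: flow N S by fact
  interpret MN: pair_prob_space M N ..
  have TS: "preserving (M \<Otimes>\<^sub>M N) (pair_flow T S)"
    by (intro preserving_pair flow_preserving assms)
  have add: "pair_flow T S (s + t) z = pair_flow T S s (pair_flow T S t z)"
    if "z \<in> space (M \<Otimes>\<^sub>M N)" for s t z
    using that by (auto simp: pair_flow_def space_pair_measure M.flow_add N.flow_add)
  have zero: "pair_flow T S 0 z = z" if "z \<in> space (M \<Otimes>\<^sub>M N)" for z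
    using that by (auto simp: pair_flow_def space_pair_measure M.flow_zero N.flow_zero)
  show ?thesis
  proof (intro flow.intro flow_axioms.intro MN.P.prob_space_axioms add zero)
    show "standard_borel (M \<Otimes>\<^sub>M N)" by (intro standard_borel_pair M.standard N.standard)
    show "\<not> (\<exists>x\<in>space (M \<Otimes>\<^sub>M N). AE y in M \<Otimes>\<^sub>M N. y = x)"
    proof safe
      fix a b assume ab: "(a, b) \<in> space (M \<Otimes>\<^sub>M N)" and "AE y in M \<Otimes>\<^sub>M N. y = (a, b)"
      from MN.AE_pair[OF this(2)] have "AE x in M. x = a"
        by (auto elim!: eventually_mono)
      with ab show False using M.nontrivial by (auto simp: space_pair_measure)
    qed
    show "pair_flow T S t \<in> measurable (M \<Otimes>\<^sub>M N) (M \<Otimes>\<^sub>M N)"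
      "distr (M \<Otimes>\<^sub>M N) (M \<Otimes>\<^sub>M N) (pair_flow T S t) = M \<Otimes>\<^sub>M N" for t
      using TS by (auto simp: preserving_def)
    fix f g assume fg: "f \<in> L2_fun (M \<Otimes>\<^sub>M N)" "g \<in> L2_fun (M \<Otimes>\<^sub>M N)"
    show "continuous_on UNIV (\<lambda>t. LINT x|(M \<Otimes>\<^sub>M N). f (pair_flow T S t x) * cnj (g x))"
      by (intro weak_L2_continuous[OF TS add _ fg] L1_continuous_indicator_pair
            flow_preserving flow_L1_continuous_indicator assms)
  qed
qed

text \<open>Exchanging the two middle factors of a fourfold product preserves the product measure.\<close>

lemma distr_pair_interchange:
  assumes "prob_space M" "prob_space N"
  shows "distr (M \<Otimes>\<^sub>M (M \<Otimes>\<^sub>M (N \<Otimes>\<^sub>M N))) ((M \<Otimes>\<^sub>M N) \<Otimes>\<^sub>M (M \<Otimes>\<^sub>M N))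
           (\<lambda>(x, x', y, y'). ((x, y), (x', y'))) = (M \<Otimes>\<^sub>M N) \<Otimes>\<^sub>M (M \<Otimes>\<^sub>M N)"
    (is "distr ?L ?R ?\<phi> = _")
proof (rule measure_eqI)
  interpret M: prob_space M by fact
  interpret N: prob_space N by fact
  interpret MN: pair_prob_space M N ..
  interpret NN: pair_prob_space N N ..
  interpret MNN: pair_prob_space M "N \<Otimes>\<^sub>M N" ..
  fix D assume "D \<in> sets (distr ?L ?R ?\<phi>)"
  then have D[measurable]: "D \<in> sets ?R" by simp
  have \<phi>: "?\<phi> \<in> measurable ?L ?R" by measurable
  have "emeasure (distr ?L ?R ?\<phi>) D = (\<integral>\<^sup>+w. indicator D w \<partial>distr ?L ?R ?\<phi>)"
    by simp
  also have "\<dots> = (\<integral>\<^sup>+w. indicator D (?\<phi> w) \<partial>?L)"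
    by (rule nn_integral_distr[OF \<phi>]) simp
  also have "\<dots> = (\<integral>\<^sup>+x. (\<integral>\<^sup>+w. indicator D (?\<phi> (x, w)) \<partial>(M \<Otimes>\<^sub>M (N \<Otimes>\<^sub>M N))) \<partial>M)"
    by (rule MNN.P.nn_integral_fst[symmetric]) measurable
  also have "\<dots> = (\<integral>\<^sup>+x. (\<integral>\<^sup>+x'. (\<integral>\<^sup>+w. indicator D (?\<phi> (x, x', w)) \<partial>(N \<Otimes>\<^sub>M N)) \<partial>M) \<partial>M)"
    by (intro nn_integral_cong NN.P.nn_integral_fst[symmetric]) measurable
  also have "\<dots> = (\<integral>\<^sup>+x. (\<integral>\<^sup>+x'. (\<integral>\<^sup>+y. (\<integral>\<^sup>+y'. indicator D ((x, y), (x', y')) \<partial>N) \<partial>N) \<partial>M) \<partial>M)"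
  proof (intro nn_integral_cong)
    fix x x' assume [measurable]: "x \<in> space M" "x' \<in> space M"
    have "(\<lambda>w. indicator D (?\<phi> (x, x', w))) \<in> borel_measurable (N \<Otimes>\<^sub>M N)" by measurable
    from N.nn_integral_fst[OF this]
    show "(\<integral>\<^sup>+w. indicator D (?\<phi> (x, x', w)) \<partial>(N \<Otimes>\<^sub>M N)) =
        (\<integral>\<^sup>+y. (\<integral>\<^sup>+y'. indicator D ((x, y), (x', y')) \<partial>N) \<partial>N)" by simp
  qed
  also have "\<dots> = (\<integral>\<^sup>+x. (\<integral>\<^sup>+y. (\<integral>\<^sup>+x'. (\<integral>\<^sup>+y'. indicator D ((x, y), (x', y')) \<partial>N) \<partial>M) \<partial>N) \<partial>M)"
    by (intro nn_integral_cong MN.Fubini'[symmetric]) measurable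
  also have "\<dots> = (\<integral>\<^sup>+x. (\<integral>\<^sup>+y. (\<integral>\<^sup>+w. indicator D ((x, y), w) \<partial>(M \<Otimes>\<^sub>M N)) \<partial>N) \<partial>M)"
    by (intro nn_integral_cong N.nn_integral_fst) measurable
  also have "\<dots> = (\<integral>\<^sup>+z. (\<integral>\<^sup>+w. indicator D (z, w) \<partial>(M \<Otimes>\<^sub>M N)) \<partial>(M \<Otimes>\<^sub>M N))"
    by (rule N.nn_integral_fst) measurable
  also have "\<dots> = emeasure ?R D"
    by (subst MN.P.nn_integral_fst) simp_all
  finally show "emeasure (distr ?L ?R ?\<phi>) D = emeasure ?R D" .
qed simp

text \<open>
  Ergodicity of \<open>(T \<times> S) \<times> (T \<times> S)\<close> is obtained from that of \<open>S \<times> S\<close> by adding the two factors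
  \<open>T\<close> one at a time, each time with \<open>ergodic_pair\<close>.
\<close>

lemma weakly_mixing_pair:
  assumes M: "weakly_mixing M T" and N: "weakly_mixing N S"
  shows "weakly_mixing (M \<Otimes>\<^sub>M N) (pair_flow T S)"
  unfolding weakly_mixing_def
proof
  show "flow (M \<Otimes>\<^sub>M N) (pair_flow T S)"
    by (intro flow_pair weakly_mixing_flow assms)
  have T: "preserving M T" and S: "preserving N S" by (intro weakly_mixing_preserving assms)+
  have SS: "preserving (N \<Otimes>\<^sub>M N) (pair_flow S S)"
    and TSS: "preserving (M \<Otimes>\<^sub>M (N \<Otimes>\<^sub>M N)) (pair_flow T (pair_flow S S))"
    and TTSS: "preserving (M \<Otimes>\<^sub>M (M \<Otimes>\<^sub>M (N \<Otimes>\<^sub>M N))) (pair_flow T (pair_flow T (pair_flow S S)))"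
    by (intro preserving_pair T S)+
  have eTT: "ergodic (M \<Otimes>\<^sub>M M) (pair_flow T T)" and eSS: "ergodic (N \<Otimes>\<^sub>M N) (pair_flow S S)"
    using M N by (simp_all add: weakly_mixing_def)
  have "ergodic (M \<Otimes>\<^sub>M (M \<Otimes>\<^sub>M (N \<Otimes>\<^sub>M N))) (pair_flow T (pair_flow T (pair_flow S S)))"
    by (intro ergodic_pair[OF T TSS eTT] ergodic_pair[OF T SS eTT] eSS)
  then show "ergodic ((M \<Otimes>\<^sub>M N) \<Otimes>\<^sub>M (M \<Otimes>\<^sub>M N)) (pair_flow (pair_flow T S) (pair_flow T S))"
    by (rule ergodic_factor[rotated 3, where \<phi> = "\<lambda>(x, x', y, y'). ((x, y), (x', y'))"])
       (use TTSS T S in \<open>auto simp: preserving_def pair_flow_def distr_pair_interchange\<close>)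
qed

text \<open>
  A strict isomorphism, with inverse \<open>\<psi>\<close>: the map \<open>\<phi>\<close> is measure preserving, and the
  maps are mutually inverse and intertwine the
  flows at every point of the spaces, not just almost everywhere. This is what is needed to
  transport the standard Borel structure and the pointwise flow laws.
\<close>

definition flow_equivalence ::
    "'a measure \<Rightarrow> (real \<Rightarrow> 'a \<Rightarrow> 'a) \<Rightarrow> 'b measure \<Rightarrow> (real \<Rightarrow> 'b \<Rightarrow> 'b) \<Rightarrow> ('a \<Rightarrow> 'b) \<Rightarrow> ('b \<Rightarrow> 'a) \<Rightarrow> bool" where
  "flow_equivalence M T N S \<phi> \<psi> \<longleftrightarrow>
     \<phi> \<in> measurable M N \<and> \<psi> \<in> measurable N M \<and> distr M N \<phi> = N \<and>
     (\<forall>x\<in>space M. \<psi> (\<phi> x) = x) \<and> (\<forall>y\<in>space N. \<phi> (\<psi> y) = y) \<and>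
     (\<forall>t. \<forall>x\<in>space M. S t (\<phi> x) = \<phi> (T t x))"

lemma flow_equivalence_flow:
  assumes "flow M T" and eq: "flow_equivalence M T N S \<phi> \<psi>"
  shows "flow N S"
proof -
  interpret flow M T by fact
  have \<phi>[measurable]: "\<phi> \<in> measurable M N" and \<psi>[measurable]: "\<psi> \<in> measurable N M"
    and d: "distr M N \<phi> = N" and \<psi>\<phi>: "\<And>x. x \<in> space M \<Longrightarrow> \<psi> (\<phi> x) = x"
    and \<phi>\<psi>: "\<And>y. y \<in> space N \<Longrightarrow> \<phi> (\<psi> y) = y"
    and S: "\<And>t x. x \<in> space M \<Longrightarrow> S t (\<phi> x) = \<phi> (T t x)"
    using eq by (auto simp: flow_equivalence_def)
  note [measurable] = measurable_flow
  have S': "S t y = \<phi> (T t (\<psi> y))" if "y \<in> space N" for t y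
    using S[of "\<psi> y" t] \<phi>\<psi>[OF that] measurable_space[OF \<psi> that] by simp
  have Sm[measurable]: "S t \<in> measurable N N" for t
    by (subst measurable_cong[OF S']) measurable
  show ?thesis
  proof (intro flow.intro flow_axioms.intro)
    show "prob_space N" using prob_space_distr[OF \<phi>] d by simp
    show "standard_borel N"
      by (rule standard_borel_transfer[OF standard \<phi> \<psi> \<psi>\<phi> \<phi>\<psi>])
    show "\<not> (\<exists>x\<in>space N. AE y in N. y = x)"
    proof safe
      fix b assume b: "b \<in> space N" and "AE y in N. y = b"
      then have "AE x in M. \<phi> x = b" by (intro AE_measure_preserving[OF \<phi> d])
      then have "AE x in M. x = \<psi> b" using AE_space by eventually_elim (auto simp: \<psi>\<phi>)
      then show False using nontrivial measurable_space[OF \<psi> b] by auto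
    qed
    show "S t \<in> measurable N N" for t by measurable
    show "distr N N (S t) = N" for t
    proof -
      have "distr N N (S t) = distr (distr M N \<phi>) N (S t)" by (simp add: d)
      also have "\<dots> = distr M N (\<lambda>x. S t (\<phi> x))" by (subst distr_distr) (auto simp: comp_def)
      also have "\<dots> = distr M N (\<lambda>x. \<phi> (T t x))" by (rule distr_cong) (auto simp: S)
      also have "\<dots> = distr (distr M M (T t)) N \<phi>" by (subst distr_distr) (auto simp: comp_def)
      finally show ?thesis by (simp add: flow_preserves d)
    qed
    show "S 0 y = y" if "y \<in> space N" for y
      using that measurable_space[OF \<psi>] by (simp add: S' flow_zero \<phi>\<psi>)
    show "S (s + t) y = S s (S t y)" if "y \<in> space N" for s t y
      using that measurable_space[OF \<psi>] measurable_space[OF measurable_flow] measurable_space[OF \<phi>]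
      by (simp add: S' flow_add \<psi>\<phi>)
    fix f g assume fg: "f \<in> L2_fun N" "g \<in> L2_fun N"
    have L2: "(\<lambda>x. f (\<phi> x)) \<in> L2_fun M" if "f \<in> L2_fun N" for f
      using that integrable_distr[OF \<phi>, of "\<lambda>y. (cmod (f y))\<^sup>2"]
      by (auto simp: L2_fun_def d intro: measurable_compose[OF \<phi>])
    have [measurable]: "cnj \<in> borel_measurable borel"
      by (intro borel_measurable_continuous_onI continuous_intros)
    have [measurable]: "f \<in> borel_measurable N" "g \<in> borel_measurable N"
      using fg by (auto simp: L2_fun_def)
    have "(LINT y|N. f (S t y) * cnj (g y)) = (LINT x|M. f (\<phi> (T t x)) * cnj (g (\<phi> x)))" for t
    proof -
      have "(LINT y|N. f (S t y) * cnj (g y)) = (LINT y|distr M N \<phi>. f (S t y) * cnj (g y))"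
        by (simp add: d)
      also have "\<dots> = (LINT x|M. f (S t (\<phi> x)) * cnj (g (\<phi> x)))"
        by (rule integral_distr) measurable
      also have "\<dots> = (LINT x|M. f (\<phi> (T t x)) * cnj (g (\<phi> x)))"
        by (rule Bochner_Integration.integral_cong) (auto simp: S)
      finally show ?thesis .
    qed
    then show "continuous_on UNIV (\<lambda>t. LINT y|N. f (S t y) * cnj (g y))"
      using flow_continuous[OF L2[OF fg(1)] L2[OF fg(2)]] by simp
  qed
qed

lemma flow_equivalence_weakly_mixing:
  assumes M: "weakly_mixing M T" and eq: "flow_equivalence M T N S \<phi> \<psi>"
  shows "weakly_mixing N S"
proof -
  note fM = weakly_mixing_flow[OF M]
  note fN = flow_equivalence_flow[OF fM eq]
  interpret M: flow M T by fact
  interpret N: flow N S by fact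
  interpret MM: pair_prob_space M M ..
  have [measurable]: "\<phi> \<in> measurable M N" and d: "distr M N \<phi> = N"
    and S: "\<And>t x. x \<in> space M \<Longrightarrow> S t (\<phi> x) = \<phi> (T t x)"
    using eq by (auto simp: flow_equivalence_def)
  have "ergodic (N \<Otimes>\<^sub>M N) (pair_flow S S)"
  proof (rule ergodic_factor[OF MM.P.prob_space_axioms, where \<phi> = "\<lambda>(x, y). (\<phi> x, \<phi> y)"])
    show "distr (M \<Otimes>\<^sub>M M) (N \<Otimes>\<^sub>M N) (\<lambda>(x, y). (\<phi> x, \<phi> y)) = N \<Otimes>\<^sub>M N"
      using pair_measure_distr[of \<phi> M N \<phi> M N] by (simp add: d N.sigma_finite_measure_axioms)
    show "ergodic (M \<Otimes>\<^sub>M M) (pair_flow T T)" using M by (simp add: weakly_mixing_def)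
    show "pair_flow T T t \<in> measurable (M \<Otimes>\<^sub>M M) (M \<Otimes>\<^sub>M M)" for t
      using flow_pair[OF fM fM] by (rule flow.measurable_flow)
    show "AE z in M \<Otimes>\<^sub>M M. (\<lambda>(x, y). (\<phi> x, \<phi> y)) (pair_flow T T t z) =
        pair_flow S S t ((\<lambda>(x, y). (\<phi> x, \<phi> y)) z)" for t
      by (rule AE_I2) (auto simp: pair_flow_def space_pair_measure S)
  qed measurable
  with fN show ?thesis by (simp add: weakly_mixing_def)
qed

text \<open>
  The copy lives on the image of an injection into the reals and carries the transported
  \<open>\<sigma>\<close>-algebra, so the injection need not be Borel.
\<close>

lemma real_copy:
  assumes "flow (M :: 'a measure) T"
  obtains N :: "real measure" and S \<phi> \<psi> where "flow_equivalence M T N S \<phi> \<psi>"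
proof -
  interpret flow M T by fact
  obtain \<iota> :: "'a \<Rightarrow> real" where \<iota>: "inj_on \<iota> (space M)"
    using standard_borel_inj_real[OF standard] by metis
  let ?N = "embed_measure M \<iota>" and ?\<psi> = "the_inv_into (space M) \<iota>"
  have \<psi>: "?\<psi> (\<iota> x) = x" if "x \<in> space M" for x
    by (rule the_inv_into_f_f[OF \<iota> that])
  have \<iota>m: "\<iota> \<in> measurable M ?N" by (rule measurable_embed_measure2'[OF \<iota>])
  have "?\<psi> \<in> measurable ?N M"
  proof (rule measurable_embed_measure1)
    show "(\<lambda>x. ?\<psi> (\<iota> x)) \<in> measurable M M"
      by (subst measurable_cong[OF \<psi>]) simp_all
  qed
  then have "flow_equivalence M T ?N (\<lambda>t y. \<iota> (T t (?\<psi> y))) \<iota> ?\<psi>"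
    unfolding flow_equivalence_def
    using \<iota>m embed_measure_eq_distr'[OF \<iota>] by (auto simp: space_embed_measure \<psi>)
  then show thesis by (rule that)
qed

lemma flow_equivalence_PiM_singleton:
  assumes "prob_space (M j)"
  shows "flow_equivalence (M j) (T j) (PiM {j} M) (product_flow {j} T) (\<lambda>x. \<lambda>i\<in>{j}. x) (\<lambda>w. w j)"
  unfolding flow_equivalence_def
proof (intro conjI allI ballI)
  show m: "(\<lambda>x. \<lambda>i\<in>{j}. x) \<in> measurable (M j) (PiM {j} M)"
    by (intro measurable_restrict) auto
  show "(\<lambda>w. w j) \<in> measurable (PiM {j} M) (M j)" by measurable
  interpret Mj: prob_space "M j" by fact
  interpret P: prob_space "PiM {j} M" by (intro prob_space_PiM) (use assms in auto)
  have "distr (distr (PiM {j} M) (M j) (\<lambda>w. w j)) (PiM {j} M) (\<lambda>x. \<lambda>i\<in>{j}. x) =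
      distr (PiM {j} M) (PiM {j} M) (\<lambda>w. \<lambda>i\<in>{j}. w j)"
    using m by (subst distr_distr) (auto simp: comp_def)
  also have "\<dots> = distr (PiM {j} M) (PiM {j} M) (\<lambda>w. w)"
    by (intro distr_cong) (auto simp: space_PiM PiE_iff extensional_def fun_eq_iff)
  also have "\<dots> = PiM {j} M" by (rule distr_id)
  finally show "distr (M j) (PiM {j} M) (\<lambda>x. \<lambda>i\<in>{j}. x) = PiM {j} M"
    using distr_PiM_component[of "{j}" M j] assms by simp
qed (auto simp: product_flow_def fun_eq_iff space_PiM PiE_iff extensional_def)

lemma flow_equivalence_PiM_insert:
  assumes M: "\<And>i. i \<in> insert j J \<Longrightarrow> prob_space (M i)" and j: "j \<notin> J"
  shows "flow_equivalence (M j \<Otimes>\<^sub>M PiM J M) (pair_flow (T j) (product_flow J T))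
           (PiM (insert j J) M) (product_flow (insert j J) T)
           (\<lambda>(x, w). w(j := x)) (\<lambda>w. (w j, restrict w J))"
  unfolding flow_equivalence_def
proof (intro conjI allI ballI)
  show "(\<lambda>(x, w). w(j := x)) \<in> measurable (M j \<Otimes>\<^sub>M PiM J M) (PiM (insert j J) M)"
    using measurable_add_dim[of j J M] measurable_compose[OF measurable_pair_swap']
    by (force simp: split_beta' comp_def)
  show "(\<lambda>w. (w j, restrict w J)) \<in> measurable (PiM (insert j J) M) (M j \<Otimes>\<^sub>M PiM J M)"
    by (intro measurable_Pair measurable_restrict_subset) auto
  show "distr (M j \<Otimes>\<^sub>M PiM J M) (PiM (insert j J) M) (\<lambda>(x, w). w(j := x)) = PiM (insert j J) M"
    by (rule distr_pair_PiM_eq_PiM) (use M in auto)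
qed (use j in \<open>auto simp: product_flow_def pair_flow_def fun_eq_iff space_PiM PiE_iff
       extensional_def space_pair_measure restrict_def\<close>)

lemma weakly_mixing_PiM:
  assumes "finite J" "J \<noteq> {}" and M: "\<And>i. i \<in> J \<Longrightarrow> weakly_mixing (M i) (T i)"
  shows "weakly_mixing (PiM J M) (product_flow J T)"
  using assms
proof (induction rule: finite_ne_induct)
  case (singleton j)
  then have "weakly_mixing (M j) (T j)" by simp
  moreover from this have "prob_space (M j)" by (metis weakly_mixing_flow flow.axioms(1))
  ultimately show ?case
    by (rule flow_equivalence_weakly_mixing[OF _ flow_equivalence_PiM_singleton])
next
  case (insert j J)
  have "prob_space (M i)" if "i \<in> insert j J" for i
    using insert.prems[OF that] by (metis weakly_mixing_flow flow.axioms(1))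
  then show ?case
    using insert by (intro flow_equivalence_weakly_mixing[OF weakly_mixing_pair flow_equivalence_PiM_insert]) auto
qed

section \<open>Factor maps into a flow with the joining primeness property\<close>

text \<open>
  \<open>g\<close> is a factor map from the flow \<open>S\<close> on \<open>N\<close> onto the flow \<open>T\<close> on \<open>M\<close>. Equivariance holds almost
  everywhere, separately for each time.
\<close>

definition flow_factor ::
    "'a measure \<Rightarrow> (real \<Rightarrow> 'a \<Rightarrow> 'a) \<Rightarrow> 'b measure \<Rightarrow> (real \<Rightarrow> 'b \<Rightarrow> 'b) \<Rightarrow> ('a \<Rightarrow> 'b) \<Rightarrow> bool" where
  "flow_factor N S M T g \<longleftrightarrow>
     g \<in> measurable N M \<and> distr N M g = M \<and> (\<forall>t. AE y in N. T t (g y) = g (S t y))"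

lemma prob_space_AE_ex:
  assumes "prob_space M" "AE x in M. P x"
  shows "\<exists>x\<in>space M. P x"
proof -
  have "AE x in M. x \<in> space M \<and> P x" using assms(2) by auto
  then show ?thesis
    using eventually_happens'[OF prob_space.ae_filter_bot[OF assms(1)]] by blast
qed

text \<open>The graph joining of a factor map is isomorphic to its source, hence ergodic with it.\<close>

lemma graph_joining:
  assumes M: "flow M T" and N: "preserving N S" and eN: "ergodic N S" and g: "flow_factor N S M T g"
  shows "distr N (M \<Otimes>\<^sub>M N) (\<lambda>y. (g y, y)) \<in> ergodic_joinings M T N S"
proof -
  interpret M: flow M T by fact
  interpret N: prob_space N using N by (simp add: preserving_def)
  note [measurable] = M.measurable_flow
  have [measurable]: "S t \<in> measurable N N" and dS: "distr N N (S t) = N" for t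
    using N by (auto simp: preserving_def)
  have gm[measurable]: "g \<in> measurable N M" and dg: "distr N M g = M"
    and eq: "\<And>t. AE y in N. T t (g y) = g (S t y)"
    using g by (auto simp: flow_factor_def)
  let ?h = "\<lambda>y. (g y, y)"
  let ?\<rho> = "distr N (M \<Otimes>\<^sub>M N) ?h"
  have h: "?h \<in> measurable N (M \<Otimes>\<^sub>M N)" by measurable
  have pf: "pair_flow T S t = (\<lambda>(x, y). (T t x, S t y))" for t by (auto simp: pair_flow_def)
  have "?\<rho> \<in> joinings M T N S"
    unfolding joinings_def
  proof (intro CollectI conjI allI)
    show "prob_space ?\<rho>" by (rule N.prob_space_distr[OF h])
    show "distr ?\<rho> M fst = M" using dg by (subst distr_distr) (auto simp: comp_def)
    show "distr ?\<rho> N snd = N" by (subst distr_distr) (auto simp: comp_def distr_id)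
    show "distr ?\<rho> (M \<Otimes>\<^sub>M N) (pair_flow T S t) = ?\<rho>" for t
    proof -
      have "distr ?\<rho> (M \<Otimes>\<^sub>M N) (pair_flow T S t) = distr N (M \<Otimes>\<^sub>M N) (\<lambda>y. (T t (g y), S t y))"
        unfolding pf by (subst distr_distr) (auto simp: comp_def)
      also have "\<dots> = distr N (M \<Otimes>\<^sub>M N) (\<lambda>y. (g (S t y), S t y))"
        by (rule distr_cong_AE) (use eq[of t] in auto)
      also have "\<dots> = distr (distr N N (S t)) (M \<Otimes>\<^sub>M N) ?h"
        by (subst distr_distr) (auto simp: comp_def)
      finally show ?thesis by (simp add: dS)
    qed
  qed simp
  moreover have "ergodic ?\<rho> (pair_flow T S)"
  proof (rule ergodic_factor[OF N.prob_space_axioms _ _ eN])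
    show "?h \<in> measurable N ?\<rho>" by simp
    show "distr N ?\<rho> ?h = ?\<rho>" by (rule distr_cong) auto
    show "AE y in N. ?h (S t y) = pair_flow T S t (?h y)" for t
      using eq[of t] by eventually_elim (simp add: pair_flow_def)
  qed measurable
  ultimately show ?thesis by (simp add: ergodic_joinings_def)
qed

text \<open>
  The key consequence of the JP property. The graph joining \<open>\<rho>\<close> is concentrated on
  \<open>x = g (y1, y2)\<close>. In the first alternative of JP, \<open>\<rho>\<close> is the product of its marginal on
  \<open>(x, y1)\<close> and of \<open>N2\<close>. Then for almost every fixed \<open>y2\<close> the equation \<open>x = g (y1, y2)\<close> holds
  almost surely under this marginal, and \<open>x\<close> is determined by \<open>y1\<close>.
\<close>

lemma joining_prime_factor_real:
  fixes N1 N2 :: "real measure"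
  assumes JP: "joining_prime M T" and N1: "weakly_mixing N1 S1" and N2: "weakly_mixing N2 S2"
    and g: "flow_factor (N1 \<Otimes>\<^sub>M N2) (pair_flow S1 S2) M T g"
  shows "(\<exists>q\<in>measurable N1 M. AE y in N1 \<Otimes>\<^sub>M N2. g y = q (fst y)) \<or>
         (\<exists>q\<in>measurable N2 M. AE y in N1 \<Otimes>\<^sub>M N2. g y = q (snd y))"
proof -
  interpret M: flow M T using JP by (simp add: joining_prime_def)
  interpret N1: flow N1 S1 by (rule weakly_mixing_flow[OF N1])
  interpret N2: flow N2 S2 by (rule weakly_mixing_flow[OF N2])
  interpret N: pair_prob_space N1 N2 ..
  let ?N = "N1 \<Otimes>\<^sub>M N2"
  have wm: "weakly_mixing ?N (pair_flow S1 S2)" by (rule weakly_mixing_pair[OF N1 N2])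
  have gm[measurable]: "g \<in> measurable ?N M" using g by (simp add: flow_factor_def)
  define \<rho> where "\<rho> = distr ?N (M \<Otimes>\<^sub>M ?N) (\<lambda>y. (g y, y))"
  have hm: "(\<lambda>y. (g y, y)) \<in> measurable ?N (M \<Otimes>\<^sub>M ?N)" by measurable
  have \<rho>_sets[measurable_cong]: "sets \<rho> = sets (M \<Otimes>\<^sub>M ?N)" by (simp add: \<rho>_def)
  interpret \<rho>: prob_space \<rho> unfolding \<rho>_def by (rule N.P.prob_space_distr[OF hm])
  let ?P = "\<lambda>z. fst z = g (snd z)"
  have Pm: "{z \<in> space (M \<Otimes>\<^sub>M ?N). ?P z} \<in> sets (M \<Otimes>\<^sub>M ?N)"
    by (rule sets_equalizer[OF M.standard]) measurable
  have Pcomp: "{w \<in> space W. ?P (F w)} \<in> sets W" if F: "F \<in> measurable W (M \<Otimes>\<^sub>M ?N)"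
    for F and W :: "'w measure"
  proof -
    have "{w \<in> space W. ?P (F w)} = F -` {z \<in> space (M \<Otimes>\<^sub>M ?N). ?P z} \<inter> space W"
      using measurable_space[OF F] by auto
    then show ?thesis using measurable_sets[OF F Pm] by simp
  qed
  have AE_\<rho>: "AE z in \<rho>. ?P z"
    unfolding \<rho>_def by (subst AE_distr_iff[OF hm Pm]) simp
  have "\<rho> \<in> ergodic_joinings M T ?N (pair_flow S1 S2)"
    unfolding \<rho>_def
    by (rule graph_joining[OF M.flow_axioms weakly_mixing_preserving[OF wm]
          weakly_mixing_ergodic[OF wm] g])
  then consider
      "\<rho> = distr (distr \<rho> (M \<Otimes>\<^sub>M N1) (\<lambda>(x, y1, y2). (x, y1)) \<Otimes>\<^sub>M N2)
                 (M \<Otimes>\<^sub>M ?N) (\<lambda>((x, y1), y2). (x, y1, y2))"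
    | "\<rho> = distr (distr \<rho> (M \<Otimes>\<^sub>M N2) (\<lambda>(x, y1, y2). (x, y2)) \<Otimes>\<^sub>M N1)
                 (M \<Otimes>\<^sub>M ?N) (\<lambda>((x, y2), y1). (x, y1, y2))"
    using JP N1 N2 unfolding joining_prime_def by blast
  then show ?thesis
  proof cases
    case 1
    let ?c = "\<lambda>(x, y1, y2). (x, y1)" and ?F = "\<lambda>((x, y1), y2). (x, y1, y2)"
    let ?R = "distr \<rho> (M \<Otimes>\<^sub>M N1) ?c"
    have cm: "?c \<in> measurable \<rho> (M \<Otimes>\<^sub>M N1)" by measurable
    interpret R: prob_space ?R by (rule \<rho>.prob_space_distr[OF cm])
    interpret RN: pair_prob_space ?R N2 ..
    have Fm: "?F \<in> measurable (?R \<Otimes>\<^sub>M N2) (M \<Otimes>\<^sub>M ?N)"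
      by (simp add: case_prod_unfold)
    have "AE w in ?R \<Otimes>\<^sub>M N2. ?P (?F w)"
      by (rule AE_distrD[OF Fm]) (subst 1[symmetric], rule AE_\<rho>)
    from RN.AE_pair[OF this] have "AE a in ?R. AE y2 in N2. ?P (?F (a, y2))" .
    then have "AE y2 in N2. AE a in ?R. ?P (?F (a, y2))"
      using Pcomp[OF Fm] by (subst RN.AE_commute[symmetric]) (simp_all del: space_distr)
    then obtain y2 where y2[measurable]: "y2 \<in> space N2" and "AE a in ?R. ?P (?F (a, y2))"
      using prob_space_AE_ex[OF N2.prob_space_axioms] by blast
    then have "AE z in \<rho>. ?P (?F (?c z, y2))" by (intro AE_distrD[OF cm])
    then have "AE y in ?N. ?P (?F (?c (g y, y), y2))"
      unfolding \<rho>_def by (rule AE_distrD[OF hm])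
    then have "AE y in ?N. g y = g (fst y, y2)" by (simp add: split_beta')
    moreover have "(\<lambda>x. g (x, y2)) \<in> measurable N1 M" by measurable
    ultimately show ?thesis by (intro disjI1 bexI[of _ "\<lambda>x. g (x, y2)"])
  next
    case 2
    let ?c = "\<lambda>(x, y1, y2). (x, y2)" and ?F = "\<lambda>((x, y2), y1). (x, y1, y2)"
    let ?R = "distr \<rho> (M \<Otimes>\<^sub>M N2) ?c"
    have cm: "?c \<in> measurable \<rho> (M \<Otimes>\<^sub>M N2)" by measurable
    interpret R: prob_space ?R by (rule \<rho>.prob_space_distr[OF cm])
    interpret RN: pair_prob_space ?R N1 ..
    have Fm: "?F \<in> measurable (?R \<Otimes>\<^sub>M N1) (M \<Otimes>\<^sub>M ?N)"
      by (simp add: case_prod_unfold)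
    have "AE w in ?R \<Otimes>\<^sub>M N1. ?P (?F w)"
      by (rule AE_distrD[OF Fm]) (subst 2[symmetric], rule AE_\<rho>)
    from RN.AE_pair[OF this] have "AE a in ?R. AE y1 in N1. ?P (?F (a, y1))" .
    then have "AE y1 in N1. AE a in ?R. ?P (?F (a, y1))"
      using Pcomp[OF Fm] by (subst RN.AE_commute[symmetric]) (simp_all del: space_distr)
    then obtain y1 where y1[measurable]: "y1 \<in> space N1" and "AE a in ?R. ?P (?F (a, y1))"
      using prob_space_AE_ex[OF N1.prob_space_axioms] by blast
    then have "AE z in \<rho>. ?P (?F (?c z, y1))" by (intro AE_distrD[OF cm])
    then have "AE y in ?N. ?P (?F (?c (g y, y), y1))"
      unfolding \<rho>_def by (rule AE_distrD[OF hm])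
    then have "AE y in ?N. g y = g (y1, snd y)" by (simp add: split_beta')
    moreover have "(\<lambda>x. g (y1, x)) \<in> measurable N2 M" by measurable
    ultimately show ?thesis by (intro disjI2 bexI[of _ "\<lambda>x. g (y1, x)"])
  qed
qed

lemma flow_equivalence_sym:
  assumes "flow M T" and eq: "flow_equivalence M T N S \<phi> \<psi>"
  shows "flow_equivalence N S M T \<psi> \<phi>"
proof -
  interpret flow M T by fact
  have [measurable]: "\<phi> \<in> measurable M N" and \<psi>: "\<psi> \<in> measurable N M"
    and d: "distr M N \<phi> = N" and \<psi>\<phi>: "\<And>x. x \<in> space M \<Longrightarrow> \<psi> (\<phi> x) = x"
    and \<phi>\<psi>: "\<And>y. y \<in> space N \<Longrightarrow> \<phi> (\<psi> y) = y"
    and S: "\<And>t x. x \<in> space M \<Longrightarrow> S t (\<phi> x) = \<phi> (T t x)"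
    using eq by (auto simp: flow_equivalence_def)
  note [measurable] = \<psi>
  have "distr N M \<psi> = distr (distr M N \<phi>) M \<psi>" by (simp add: d)
  also have "\<dots> = distr M M (\<lambda>x. \<psi> (\<phi> x))" by (subst distr_distr) (auto simp: comp_def)
  also have "\<dots> = distr M M (\<lambda>x. x)" by (rule distr_cong) (auto simp: \<psi>\<phi>)
  finally have "distr N M \<psi> = M" by (simp add: distr_id)
  moreover have "T t (\<psi> y) = \<psi> (S t y)" if "y \<in> space N" for t y
    using S[of "\<psi> y" t] measurable_space[OF \<psi> that] measurable_space[OF measurable_flow]
    by (simp add: \<phi>\<psi>[OF that] \<psi>\<phi>)
  ultimately show ?thesis
    using eq by (auto simp: flow_equivalence_def)
qed

lemma flow_equivalence_pair:
  assumes "prob_space N1" "prob_space N2"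
    and "flow_equivalence M1 T1 N1 S1 \<phi>1 \<psi>1" and "flow_equivalence M2 T2 N2 S2 \<phi>2 \<psi>2"
  shows "flow_equivalence (M1 \<Otimes>\<^sub>M M2) (pair_flow T1 T2) (N1 \<Otimes>\<^sub>M N2) (pair_flow S1 S2)
    (\<lambda>(x, y). (\<phi>1 x, \<phi>2 y)) (\<lambda>(x, y). (\<psi>1 x, \<psi>2 y))"
proof -
  interpret N2: prob_space N2 by fact
  have [measurable]: "\<phi>1 \<in> measurable M1 N1" "\<phi>2 \<in> measurable M2 N2"
    "\<psi>1 \<in> measurable N1 M1" "\<psi>2 \<in> measurable N2 M2"
    using assms by (auto simp: flow_equivalence_def)
  have "distr (M1 \<Otimes>\<^sub>M M2) (N1 \<Otimes>\<^sub>M N2) (\<lambda>(x, y). (\<phi>1 x, \<phi>2 y)) = N1 \<Otimes>\<^sub>M N2"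
    using pair_measure_distr[of \<phi>1 M1 N1 \<phi>2 M2 N2] assms N2.sigma_finite_measure_axioms
    by (simp add: flow_equivalence_def)
  then show ?thesis
    using assms(3,4) unfolding flow_equivalence_def
    by (auto simp: space_pair_measure pair_flow_def)
qed

lemma flow_factor_equivalence:
  assumes g: "flow_factor N S M T g" and eq: "flow_equivalence N' S' N S \<phi> \<psi>"
  shows "flow_factor N' S' M T (\<lambda>y. g (\<phi> y))"
  unfolding flow_factor_def
proof (intro conjI allI)
  have \<phi>[measurable]: "\<phi> \<in> measurable N' N" and d: "distr N' N \<phi> = N"
    and S: "\<And>t x. x \<in> space N' \<Longrightarrow> S t (\<phi> x) = \<phi> (S' t x)"
    using eq by (auto simp: flow_equivalence_def)
  have [measurable]: "g \<in> measurable N M" and dg: "distr N M g = M"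
    and eqg: "\<And>t. AE y in N. T t (g y) = g (S t y)"
    using g by (auto simp: flow_factor_def)
  show "(\<lambda>y. g (\<phi> y)) \<in> measurable N' M" by measurable
  have "distr N' M (\<lambda>y. g (\<phi> y)) = distr (distr N' N \<phi>) M g"
    by (subst distr_distr) (auto simp: comp_def)
  then show "distr N' M (\<lambda>y. g (\<phi> y)) = M" by (simp add: d dg)
  fix t
  have "AE y in N'. T t (g (\<phi> y)) = g (S t (\<phi> y))"
    by (rule AE_measure_preserving[OF \<phi> d eqg])
  then show "AE y in N'. T t (g (\<phi> y)) = g (\<phi> (S' t y))"
    using AE_space by eventually_elim (simp add: S)
qed

text \<open>The restriction to flows on sets of reals is removed by passing to isomorphic copies.\<close>

lemma joining_prime_factor:
  assumes JP: "joining_prime M T" and N1: "weakly_mixing N1 S1" and N2: "weakly_mixing N2 S2"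
    and g: "flow_factor (N1 \<Otimes>\<^sub>M N2) (pair_flow S1 S2) M T g"
  shows "(\<exists>q\<in>measurable N1 M. AE y in N1 \<Otimes>\<^sub>M N2. g y = q (fst y)) \<or>
         (\<exists>q\<in>measurable N2 M. AE y in N1 \<Otimes>\<^sub>M N2. g y = q (snd y))"
proof -
  note f1 = weakly_mixing_flow[OF N1] and f2 = weakly_mixing_flow[OF N2]
  obtain R1 :: "real measure" and U1 \<phi>1 \<psi>1 where e1: "flow_equivalence N1 S1 R1 U1 \<phi>1 \<psi>1"
    by (rule real_copy[OF f1])
  obtain R2 :: "real measure" and U2 \<phi>2 \<psi>2 where e2: "flow_equivalence N2 S2 R2 U2 \<phi>2 \<psi>2"
    by (rule real_copy[OF f2])
  have R: "weakly_mixing R1 U1" "weakly_mixing R2 U2"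
    by (rule flow_equivalence_weakly_mixing[OF N1 e1] flow_equivalence_weakly_mixing[OF N2 e2])+
  have pR: "prob_space R1" "prob_space R2" and pN: "prob_space N1" "prob_space N2"
    using R N1 N2 by (auto dest!: weakly_mixing_preserving simp: preserving_def)
  let ?\<Phi> = "\<lambda>(x, y). (\<phi>1 x, \<phi>2 y)" and ?\<Psi> = "\<lambda>(x, y). (\<psi>1 x, \<psi>2 y)"
  have e: "flow_equivalence (N1 \<Otimes>\<^sub>M N2) (pair_flow S1 S2) (R1 \<Otimes>\<^sub>M R2) (pair_flow U1 U2) ?\<Phi> ?\<Psi>"
    by (rule flow_equivalence_pair[OF pR e1 e2])
  have e': "flow_equivalence (R1 \<Otimes>\<^sub>M R2) (pair_flow U1 U2) (N1 \<Otimes>\<^sub>M N2) (pair_flow S1 S2) ?\<Psi> ?\<Phi>"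
    by (rule flow_equivalence_sym[OF flow_pair[OF f1 f2] e])
  have \<Phi>: "?\<Phi> \<in> measurable (N1 \<Otimes>\<^sub>M N2) (R1 \<Otimes>\<^sub>M R2)"
      "distr (N1 \<Otimes>\<^sub>M N2) (R1 \<Otimes>\<^sub>M R2) ?\<Phi> = R1 \<Otimes>\<^sub>M R2"
    and inv: "\<And>y. y \<in> space (N1 \<Otimes>\<^sub>M N2) \<Longrightarrow> ?\<Psi> (?\<Phi> y) = y"
    using e by (auto simp: flow_equivalence_def)
  have \<phi>: "\<phi>1 \<in> measurable N1 R1" "\<phi>2 \<in> measurable N2 R2"
    using e1 e2 by (auto simp: flow_equivalence_def)
  have pull: "AE y in N1 \<Otimes>\<^sub>M N2. g y = k (?\<Phi> y)"
    if "AE y in R1 \<Otimes>\<^sub>M R2. g (?\<Psi> y) = k y" for k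
    using AE_measure_preserving[OF \<Phi> that] AE_space
    by eventually_elim (simp only: inv)
  have "(\<exists>q\<in>measurable R1 M. AE y in R1 \<Otimes>\<^sub>M R2. g (?\<Psi> y) = q (fst y)) \<or>
        (\<exists>q\<in>measurable R2 M. AE y in R1 \<Otimes>\<^sub>M R2. g (?\<Psi> y) = q (snd y))"
    by (rule joining_prime_factor_real[OF JP R flow_factor_equivalence[OF g e']])
  then show ?thesis
  proof (elim disjE bexE)
    fix q assume q: "q \<in> measurable R1 M" and "AE y in R1 \<Otimes>\<^sub>M R2. g (?\<Psi> y) = q (fst y)"
    from pull[OF this(2)] have "AE y in N1 \<Otimes>\<^sub>M N2. g y = (\<lambda>x. q (\<phi>1 x)) (fst y)"
      by (simp add: split_beta')
    with measurable_compose[OF \<phi>(1) q] show ?thesis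
      by (intro disjI1 bexI[of _ "\<lambda>x. q (\<phi>1 x)"]) simp_all
  next
    fix q assume q: "q \<in> measurable R2 M" and "AE y in R1 \<Otimes>\<^sub>M R2. g (?\<Psi> y) = q (snd y)"
    from pull[OF this(2)] have "AE y in N1 \<Otimes>\<^sub>M N2. g y = (\<lambda>x. q (\<phi>2 x)) (snd y)"
      by (simp add: split_beta')
    with measurable_compose[OF \<phi>(2) q] show ?thesis
      by (intro disjI2 bexI[of _ "\<lambda>x. q (\<phi>2 x)"]) simp_all
  qed
qed

text \<open>
  Induction on the number of coordinates. When \<open>g\<close> does not depend on the split off coordinate,
  it induces a factor map of the remaining product, to which the induction hypothesis applies.
\<close>

lemma joining_prime_factor_PiM:
  assumes JP: "joining_prime N S" and J: "finite J" "J \<noteq> {}"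
    and M: "\<And>i. i \<in> J \<Longrightarrow> weakly_mixing (M i) (T i)"
    and g: "flow_factor (PiM J M) (product_flow J T) N S g"
  shows "\<exists>j\<in>J. \<exists>q\<in>measurable (M j) N. AE w in PiM J M. g w = q (w j)"
  using J M g
proof (induction arbitrary: g rule: finite_ne_induct)
  case (singleton j)
  let ?\<phi> = "\<lambda>x. \<lambda>i\<in>{j}. x"
  have \<phi>: "?\<phi> \<in> measurable (M j) (PiM {j} M)" by (intro measurable_restrict) auto
  have "g \<in> measurable (PiM {j} M) N" using singleton.prems(2) by (simp add: flow_factor_def)
  from measurable_compose[OF \<phi> this] have "(\<lambda>x. g (?\<phi> x)) \<in> measurable (M j) N" .
  moreover have "g w = g (?\<phi> (w j))" if "w \<in> space (PiM {j} M)" for w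
    using that by (intro arg_cong[of _ _ g]) (auto simp: space_PiM PiE_iff extensional_def fun_eq_iff)
  ultimately show ?case by (intro bexI[of _ j] bexI[of _ "\<lambda>x. g (?\<phi> x)"] AE_I2) auto
next
  case (insert j J)
  have wj: "weakly_mixing (M j) (T j)" and wJ: "weakly_mixing (PiM J M) (product_flow J T)"
    using insert by (auto intro!: weakly_mixing_PiM)
  have prob: "prob_space (M i)" if "i \<in> insert j J" for i
    using insert.prems(1)[OF that] by (metis weakly_mixing_flow flow.axioms(1))
  interpret Mj: prob_space "M j" by (rule prob) simp
  interpret PJ: prob_space "PiM J M" by (rule prob_space_PiM) (simp add: prob)
  interpret P: pair_prob_space "M j" "PiM J M" ..
  let ?\<phi> = "\<lambda>(x, w). w(j := x)" and ?\<psi> = "\<lambda>w. (w j, restrict w J)"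
  let ?Q = "M j \<Otimes>\<^sub>M PiM J M" and ?S = "pair_flow (T j) (product_flow J T)"
  have e: "flow_equivalence ?Q ?S (PiM (insert j J) M) (product_flow (insert j J) T) ?\<phi> ?\<psi>"
    by (intro flow_equivalence_PiM_insert prob insert.hyps)
  have fQ: "flow ?Q ?S" by (intro flow_pair weakly_mixing_flow wj wJ)
  have e': "flow_equivalence (PiM (insert j J) M) (product_flow (insert j J) T) ?Q ?S ?\<psi> ?\<phi>"
    by (rule flow_equivalence_sym[OF fQ e])
  have g': "flow_factor ?Q ?S N S (\<lambda>y. g (?\<phi> y))"
    by (rule flow_factor_equivalence[OF insert.prems(2) e])
  have \<psi>: "?\<psi> \<in> measurable (PiM (insert j J) M) ?Q" "distr (PiM (insert j J) M) ?Q ?\<psi> = ?Q"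
    and inv: "\<And>w. w \<in> space (PiM (insert j J) M) \<Longrightarrow> ?\<phi> (?\<psi> w) = w"
    using e' by (auto simp: flow_equivalence_def)
  have pull: "AE w in PiM (insert j J) M. g w = k (?\<psi> w)"
    if "AE y in ?Q. g (?\<phi> y) = k y" for k
    using AE_measure_preserving[OF \<psi> that] AE_space
    by eventually_elim (simp only: inv)
  have "(\<exists>q\<in>measurable (M j) N. AE y in ?Q. g (?\<phi> y) = q (fst y)) \<or>
        (\<exists>q\<in>measurable (PiM J M) N. AE y in ?Q. g (?\<phi> y) = q (snd y))"
    by (rule joining_prime_factor[OF JP wj wJ g'])
  then show ?case
  proof (elim disjE bexE)
    fix q assume "q \<in> measurable (M j) N" "AE y in ?Q. g (?\<phi> y) = q (fst y)"
    with pull[of "\<lambda>y. q (fst y)"] show ?thesis by auto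
  next
    fix q assume q: "q \<in> measurable (PiM J M) N" and gq: "AE y in ?Q. g (?\<phi> y) = q (snd y)"
    have "flow_factor (PiM J M) (product_flow J T) N S q"
      unfolding flow_factor_def
    proof (intro conjI allI q)
      have "N = distr ?Q N (\<lambda>y. g (?\<phi> y))" using g' by (simp add: flow_factor_def)
      also have "\<dots> = distr ?Q N (\<lambda>y. q (snd y))"
        by (rule distr_cong_AE) (use gq g' q in \<open>auto simp: flow_factor_def\<close>)
      also have "\<dots> = distr (distr ?Q (PiM J M) snd) N q"
        using q by (subst distr_distr) (auto simp: comp_def)
      also have "\<dots> = distr (PiM J M) N q"
        by (simp add: distr_pair_snd Mj.prob_space_axioms PJ.sigma_finite_measure_axioms)
      finally show "distr (PiM J M) N q = N" by simp
      fix t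
      have "AE y in ?Q. S t (g (?\<phi> y)) = g (?\<phi> (?S t y))"
        using g' by (simp add: flow_factor_def)
      moreover have "AE y in ?Q. g (?\<phi> (?S t y)) = q (snd (?S t y))"
        by (rule preserving_AE[OF flow_preserving[OF fQ] gq])
      ultimately have "AE y in ?Q. S t (q (snd y)) = q (product_flow J T t (snd y))"
        using gq by eventually_elim (simp add: pair_flow_def)
      from P.AE_pair[OF this] have "AE x in M j. AE w in PiM J M. S t (q w) = q (product_flow J T t w)"
        by simp
      then show "AE w in PiM J M. S t (q w) = q (product_flow J T t w)"
        by (simp only: Mj.AE_const)
    qed
    then obtain i r where i: "i \<in> J" and r: "r \<in> measurable (M i) N"
        and "AE w in PiM J M. q w = r (w i)"
      using insert.IH[of q] insert.prems(1) by blast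
    then have "AE y in ?Q. q (snd y) = r (snd y i)"
      by (intro AE_pair_sndI Mj.prob_space_axioms PJ.sigma_finite_measure_axioms)
    with gq have "AE y in ?Q. g (?\<phi> y) = r (snd y i)" by eventually_elim simp
    from pull[OF this] have "AE w in PiM (insert j J) M. g w = r (w i)" using i by simp
    with i r show ?thesis by blast
  qed
qed

section \<open>The centralizer of a product\<close>

lemma isomorphic_flows_inverse:
  assumes N: "preserving N S" and iso: "flow_isomorphism N S M T \<Phi>"
  shows "isomorphic_flows M T N S"
proof -
  obtain \<Psi> where \<Phi>: "\<Phi> \<in> measurable N M" and d: "distr N M \<Phi> = M" and \<Psi>: "\<Psi> \<in> measurable M N"
    and \<Psi>\<Phi>: "AE y in N. \<Psi> (\<Phi> y) = y" and \<Phi>\<Psi>: "AE x in M. \<Phi> (\<Psi> x) = x"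
    and eq: "\<And>t. AE y in N. T t (\<Phi> y) = \<Phi> (S t y)"
    using iso unfolding flow_isomorphism_def mp_isomorphism_def by blast
  have "distr M N \<Psi> = distr (distr N M \<Phi>) N \<Psi>" by (simp add: d)
  also have "\<dots> = distr N N (\<lambda>y. \<Psi> (\<Phi> y))"
    using \<Phi> \<Psi> by (subst distr_distr) (auto simp: comp_def)
  also have "\<dots> = distr N N (\<lambda>y. y)"
    by (rule distr_cong_AE) (use \<Psi>\<Phi> \<Phi> \<Psi> in auto)
  finally have d': "distr M N \<Psi> = N" by (simp add: distr_id)
  have "AE x in M. S t (\<Psi> x) = \<Psi> (T t x)" for t
  proof -
    have "AE x in M. T t (\<Phi> (\<Psi> x)) = \<Phi> (S t (\<Psi> x))"
      by (rule AE_measure_preserving[OF \<Psi> d' eq])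
    moreover have "AE x in M. \<Psi> (\<Phi> (S t (\<Psi> x))) = S t (\<Psi> x)"
      by (rule AE_measure_preserving[OF \<Psi> d' preserving_AE[OF N \<Psi>\<Phi>]])
    ultimately show ?thesis using \<Phi>\<Psi> by eventually_elim simp
  qed
  then have "flow_isomorphism M T N S \<Psi>"
    unfolding flow_isomorphism_def mp_isomorphism_def using \<Phi> \<Psi> \<Psi>\<Phi> \<Phi>\<Psi> d' by blast
  then show ?thesis by (auto simp: isomorphic_flows_def)
qed

theorem centralizer_product_flow:
  fixes I :: "'i set" and M :: "'i \<Rightarrow> 'a measure" and T :: "'i \<Rightarrow> real \<Rightarrow> 'a \<Rightarrow> 'a"
  assumes fin: "finite I" and ne: "I \<noteq> {}"
    and wm: "\<And>i. i \<in> I \<Longrightarrow> weakly_mixing (M i) (T i)"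
    and JP: "\<And>i. i \<in> I \<Longrightarrow> joining_prime (M i) (T i)"
    and R: "R \<in> centralizer (PiM I M) (product_flow I T)"
  shows "\<exists>\<sigma>. \<sigma> permutes I \<and>
           (\<forall>i\<in>I. isomorphic_flows (M i) (T i) (M (\<sigma> i)) (T (\<sigma> i))) \<and>
           (\<exists>Q. (\<forall>i\<in>I. flow_isomorphism (M (\<sigma> i)) (T (\<sigma> i)) (M i) (T i) (Q i)) \<and>
                (AE x in PiM I M. R x = (\<lambda>i\<in>I. Q i (x (\<sigma> i)))))"
proof -
  let ?P = "PiM I M" and ?S = "product_flow I T"
  have flow: "flow (M i) (T i)" if "i \<in> I" for i by (rule weakly_mixing_flow[OF wm[OF that]])
  have prob: "prob_space (M i)" if "i \<in> I" for i using flow[OF that] by (rule flow.axioms(1))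
  have std: "standard_borel (M i)" if "i \<in> I" for i using flow[OF that] by (rule flow.standard)
  have Tm: "T i t \<in> measurable (M i) (M i)" if "i \<in> I" for i t
    using flow[OF that] by (rule flow.measurable_flow)
  have comp: "(\<lambda>x. x i) \<in> measurable ?P (M i)" "distr ?P (M i) (\<lambda>x. x i) = M i" if "i \<in> I" for i
    by (rule measurable_component_singleton[OF that], rule distr_PiM_component)
      (auto intro: prob that)
  interpret P: prob_space ?P by (rule prob_space_PiM) (rule prob)
  have pS: "preserving ?P ?S"
    by (rule weakly_mixing_preserving[OF weakly_mixing_PiM[OF fin ne]]) (rule wm)
  obtain \<Psi> where Rm: "R \<in> measurable ?P ?P" and dR: "distr ?P ?P R = ?P"
    and \<Psi>: "\<Psi> \<in> measurable ?P ?P" and \<Psi>R: "AE x in ?P. \<Psi> (R x) = x"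
    and Req: "\<And>t. AE x in ?P. R (?S t x) = ?S t (R x)"
    using R unfolding centralizer_def mp_isomorphism_def by blast

  have R_factor: "flow_factor ?P ?S (M i) (T i) (\<lambda>x. R x i)" if i: "i \<in> I" for i
    unfolding flow_factor_def
  proof (intro conjI allI)
    show "(\<lambda>x. R x i) \<in> measurable ?P (M i)" by (rule measurable_compose[OF Rm comp(1)[OF i]])
    have "distr ?P (M i) (\<lambda>x. R x i) = distr (distr ?P ?P R) (M i) (\<lambda>x. x i)"
      using Rm comp(1)[OF i] by (subst distr_distr) (auto simp: comp_def)
    then show "distr ?P (M i) (\<lambda>x. R x i) = M i" by (simp only: dR comp(2)[OF i])
    show "AE x in ?P. T i t (R x i) = R (?S t x) i" for t
      using Req[of t] by eventually_elim (use i in \<open>simp add: product_flow_def\<close>)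
  qed
  have "\<forall>i\<in>I. \<exists>j. j \<in> I \<and> (\<exists>q\<in>measurable (M j) (M i). AE x in ?P. R x i = q (x j))"
  proof
    fix i assume i: "i \<in> I"
    have "\<exists>j\<in>I. \<exists>q\<in>measurable (M j) (M i). AE x in ?P. R x i = q (x j)"
      by (rule joining_prime_factor_PiM[OF JP[OF i] fin ne wm R_factor[OF i]])
    then show "\<exists>j. j \<in> I \<and> (\<exists>q\<in>measurable (M j) (M i). AE x in ?P. R x i = q (x j))"
      by (simp only: Bex_def[of I])
  qed
  from bchoice[OF this] obtain s where s': "\<forall>i\<in>I. s i \<in> I \<and>
      (\<exists>q\<in>measurable (M (s i)) (M i). AE x in ?P. R x i = q (x (s i)))" ..
  then have "\<forall>i\<in>I. \<exists>q. q \<in> measurable (M (s i)) (M i) \<and> (AE x in ?P. R x i = q (x (s i)))"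
    by blast
  from bchoice[OF this] obtain Q where Q': "\<forall>i\<in>I. Q i \<in> measurable (M (s i)) (M i) \<and>
      (AE x in ?P. R x i = Q i (x (s i)))" ..
  have s: "s i \<in> I" and Q: "Q i \<in> measurable (M (s i)) (M i)"
    and RQ: "AE x in ?P. R x i = Q i (x (s i))" if "i \<in> I" for i
    using bspec[OF s' that] bspec[OF Q' that] by blast+

  define G where "G x = (\<lambda>i\<in>I. Q i (x (s i)))" for x
  have G: "G \<in> measurable ?P ?P"
    unfolding G_def[abs_def]
    by (intro measurable_restrict measurable_compose[OF comp(1) Q] s)
  have "AE x in ?P. \<forall>i\<in>I. R x i = Q i (x (s i))"
    by (intro AE_finite_allI fin RQ)
  then have RG: "AE x in ?P. R x = G x"
    using AE_space
  proof eventually_elim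
    case (elim x)
    from measurable_space[OF Rm elim(2)] have "R x \<in> extensional I" by (simp add: space_PiM PiE_def)
    with elim(1) show ?case by (auto simp: G_def fun_eq_iff extensional_def)
  qed
  have \<Psi>G: "AE x in ?P. \<Psi> (G x) = x" using \<Psi>R RG by eventually_elim simp

  \<comment> \<open>With the other coordinates frozen at generic values \<open>w\<close>, almost every \<open>y\<close> in the
    \<open>j\<close>-th space is recovered from \<open>G (w(j := y))\<close>.\<close>
  have recover: "\<exists>w\<in>space (PiM (I - {j}) M). AE y in M j. \<Psi> (G (w(j := y))) j = y" if j: "j \<in> I" for j
  proof -
    let ?J = "I - {j}"
    let ?W = "PiM ?J M" and ?\<phi> = "\<lambda>(y, w). w(j := y)"
    interpret Mj: prob_space "M j" by (rule prob[OF j])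
    interpret W: prob_space ?W by (rule prob_space_PiM) (simp add: prob)
    interpret MW: pair_prob_space "M j" ?W ..
    have ins: "insert j ?J = I" using j by auto
    have "flow_equivalence (M j \<Otimes>\<^sub>M ?W) (pair_flow (T j) (product_flow ?J T))
        (PiM (insert j ?J) M) (product_flow (insert j ?J) T) ?\<phi> (\<lambda>w. (w j, restrict w ?J))"
      by (rule flow_equivalence_PiM_insert) (use j prob in auto)
    then have \<phi>: "?\<phi> \<in> measurable (M j \<Otimes>\<^sub>M ?W) ?P" "distr (M j \<Otimes>\<^sub>M ?W) ?P ?\<phi> = ?P"
      unfolding ins by (auto simp: flow_equivalence_def)
    have "AE z in M j \<Otimes>\<^sub>M ?W. \<Psi> (G (?\<phi> z)) = ?\<phi> z"
      by (rule AE_measure_preserving[OF \<phi> \<Psi>G])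
    then have "AE z in M j \<Otimes>\<^sub>M ?W. \<Psi> (G (?\<phi> z)) j = fst z"
      by eventually_elim (simp add: split_beta')
    from MW.AE_pair[OF this] have "AE y in M j. AE w in ?W. \<Psi> (G (?\<phi> (y, w))) j = y" by simp
    moreover have "{z \<in> space (M j \<Otimes>\<^sub>M ?W). \<Psi> (G (?\<phi> z)) j = fst z} \<in> sets (M j \<Otimes>\<^sub>M ?W)"
      by (intro sets_equalizer[OF std[OF j]] measurable_fst
          measurable_compose[OF measurable_compose[OF measurable_compose[OF \<phi>(1) G] \<Psi>] comp(1)[OF j]])
    ultimately have "AE w in ?W. AE y in M j. \<Psi> (G (?\<phi> (y, w))) j = y"
      by (subst MW.AE_commute[symmetric]) simp_all
    from prob_space_AE_ex[OF W.prob_space_axioms this] show ?thesis by simp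
  qed

  \<comment> \<open>If \<open>j\<close> is not a value of \<open>s\<close>, then \<open>G (w(j := y))\<close> does not depend on \<open>y\<close>, so the
    \<open>j\<close>-th flow would be trivial.\<close>
  have surj: "s ` I = I"
  proof (intro equalityI subsetI)
    fix j assume j: "j \<in> I"
    show "j \<in> s ` I"
    proof (rule ccontr)
      assume ns: "j \<notin> s ` I"
      obtain w where w: "AE y in M j. \<Psi> (G (w(j := y))) j = y"
        using recover[OF j] by blast
      have "G (w(j := y)) = G w" for y
        unfolding G_def using ns by (intro restrict_ext) auto
      with w have *: "AE y in M j. y = \<Psi> (G w) j" by (auto elim: eventually_mono)
      with prob_space_AE_ex[OF prob[OF j]] have "\<Psi> (G w) j \<in> space (M j)" by blast
      with * show False using flow.nontrivial[OF flow[OF j]] by blast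
    qed
  qed (use s in auto)
  have inj: "inj_on s I" using finite_surj_inj[OF fin] surj by (metis eq_card_imp_inj_on fin)

  have Q_factor: "flow_factor (M (s i)) (T (s i)) (M i) (T i) (Q i)" if i: "i \<in> I" for i
    unfolding flow_factor_def
  proof (intro conjI allI Q[OF i])
    note c = comp[OF s[OF i]]
    have "distr (M (s i)) (M i) (Q i) = distr (distr ?P (M (s i)) (\<lambda>x. x (s i))) (M i) (Q i)"
      by (simp only: c)
    also have "\<dots> = distr ?P (M i) (\<lambda>x. Q i (x (s i)))"
      using c(1) Q[OF i] by (subst distr_distr) (auto simp: comp_def)
    also have "\<dots> = distr ?P (M i) (\<lambda>x. R x i)"
      using RQ[OF i] R_factor[OF i] measurable_compose[OF c(1) Q[OF i]]
      by (intro distr_cong_AE) (auto simp: flow_factor_def)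
    finally show "distr (M (s i)) (M i) (Q i) = M i" using R_factor[OF i] by (simp add: flow_factor_def)
    fix t
    have "AE x in ?P. T i t (R x i) = R (?S t x) i" using R_factor[OF i] by (simp add: flow_factor_def)
    moreover have "AE x in ?P. R (?S t x) i = Q i (?S t x (s i))"
      by (rule preserving_AE[OF pS RQ[OF i]])
    ultimately have *: "AE x in ?P. T i t (Q i (x (s i))) = Q i (T (s i) t (x (s i)))"
      using RQ[OF i] by eventually_elim (use s[OF i] in \<open>simp add: product_flow_def\<close>)
    have "{y \<in> space (M (s i)). T i t (Q i y) = Q i (T (s i) t y)} \<in> sets (M (s i))"
      by (intro sets_equalizer[OF std[OF i]] measurable_compose[OF Q[OF i] Tm[OF i]]
          measurable_compose[OF Tm[OF s[OF i]] Q[OF i]])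
    from AE_distr_iff[OF c(1) this] *
    show "AE y in M (s i). T i t (Q i y) = Q i (T (s i) t y)" by (simp only: c)
  qed

  have Q_iso: "flow_isomorphism (M (s i)) (T (s i)) (M i) (T i) (Q i)" if i: "i \<in> I" for i
  proof -
    let ?j = "s i"
    have dQ: "distr (M ?j) (M i) (Q i) = M i" using Q_factor[OF i] by (simp add: flow_factor_def)
    obtain w where w: "w \<in> space (PiM (I - {?j}) M)"
        and wG: "AE y in M ?j. \<Psi> (G (w(?j := y))) ?j = y"
      using recover[OF s[OF i]] by blast
    \<comment> \<open>As \<open>s\<close> is injective, \<open>G (w(s i := y))\<close> depends on \<open>y\<close> only through \<open>Q i y\<close>, its
      \<open>i\<close>-th entry; \<open>E\<close> is this dependence.\<close>
    define E where "E z = (\<lambda>k\<in>I. if k = i then z else Q k (w (s k)))" for z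
    have E: "E \<in> measurable (M i) ?P"
      unfolding E_def[abs_def]
    proof (rule measurable_restrict)
      fix k assume k: "k \<in> I"
      show "(\<lambda>z. if k = i then z else Q k (w (s k))) \<in> measurable (M i) (M k)"
      proof (cases "k = i")
        case False
        then have "s k \<in> I - {?j}" using inj i k s[OF k] by (auto dest: inj_onD)
        then have "w (s k) \<in> space (M (s k))" using w by (auto simp: space_PiM)
        then show ?thesis using False measurable_space[OF Q[OF k]] by simp
      qed simp
    qed
    have EQ: "G (w(?j := y)) = E (Q i y)" for y
      unfolding G_def E_def using inj i by (intro restrict_ext) (auto dest: inj_onD)
    define \<Theta> where "\<Theta> z = \<Psi> (E z) ?j" for z
    have \<Theta>: "\<Theta> \<in> measurable (M i) (M ?j)"
      unfolding \<Theta>_def[abs_def]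
      by (rule measurable_compose[OF measurable_compose[OF E \<Psi>] comp(1)[OF s[OF i]]])
    have \<Theta>Q: "AE y in M ?j. \<Theta> (Q i y) = y" using wG by (simp add: \<Theta>_def EQ)
    have "{z \<in> space (M i). Q i (\<Theta> z) = z} \<in> sets (M i)"
      by (intro sets_equalizer[OF std[OF i]] measurable_compose[OF \<Theta> Q[OF i]]) simp
    moreover have "AE y in M ?j. Q i (\<Theta> (Q i y)) = Q i y"
      using \<Theta>Q by eventually_elim simp
    ultimately have "AE z in distr (M ?j) (M i) (Q i). Q i (\<Theta> z) = z"
      by (subst AE_distr_iff[OF Q[OF i]])
    then have "AE z in M i. Q i (\<Theta> z) = z" by (simp only: dQ)
    with \<Theta> \<Theta>Q Q_factor[OF i] show ?thesis
      by (auto simp: flow_isomorphism_def mp_isomorphism_def flow_factor_def)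
  qed

  \<comment> \<open>A permutation of \<open>I\<close> fixes every point outside \<open>I\<close>.\<close>
  define \<sigma> where "\<sigma> i = (if i \<in> I then s i else i)" for i
  have \<sigma>: "\<sigma> i = s i" if "i \<in> I" for i using that by (simp add: \<sigma>_def)
  have "bij_betw \<sigma> I I"
    using inj surj \<sigma> by (simp add: bij_betw_def cong: inj_on_cong image_cong)
  then have "\<sigma> permutes I" by (rule bij_imp_permutes) (simp add: \<sigma>_def)
  moreover have "\<forall>i\<in>I. isomorphic_flows (M i) (T i) (M (\<sigma> i)) (T (\<sigma> i))"
    using isomorphic_flows_inverse[OF flow_preserving[OF flow] Q_iso] s \<sigma> by metis
  moreover have "\<forall>i\<in>I. flow_isomorphism (M (\<sigma> i)) (T (\<sigma> i)) (M i) (T i) (Q i)"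
    using Q_iso \<sigma> by metis
  moreover have "G x = (\<lambda>i\<in>I. Q i (x (\<sigma> i)))" for x
    unfolding G_def using \<sigma> by (intro restrict_ext) simp
  then have "AE x in ?P. R x = (\<lambda>i\<in>I. Q i (x (\<sigma> i)))" using RG by simp
  ultimately show ?thesis by blast
qed

theorem corollary2:
  fixes d :: nat
    and M :: "nat \<Rightarrow> 'a measure"
    and T :: "nat \<Rightarrow> real \<Rightarrow> 'a \<Rightarrow> 'a"
    and R :: "(nat \<Rightarrow> 'a) \<Rightarrow> (nat \<Rightarrow> 'a)"
  assumes "d \<ge> 1"
    and "\<And>i. i \<in> {1..d} \<Longrightarrow> weakly_mixing (M i) (T i)"
    and "\<And>i. i \<in> {1..d} \<Longrightarrow> joining_prime (M i) (T i)"
    and "R \<in> centralizer (PiM {1..d} M) (product_flow {1..d} T)"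
  shows "\<exists>\<sigma>. \<sigma> permutes {1..d} \<and>
           (\<forall>i\<in>{1..d}. isomorphic_flows (M i) (T i) (M (\<sigma> i)) (T (\<sigma> i))) \<and>
           (\<exists>Q. (\<forall>i\<in>{1..d}. flow_isomorphism (M (\<sigma> i)) (T (\<sigma> i)) (M i) (T i) (Q i)) \<and>
                (AE x in PiM {1..d} M. R x = (\<lambda>i\<in>{1..d}. Q i (x (\<sigma> i)))))"
  using assms by (intro centralizer_product_flow) auto

end
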